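(* Let $v\le w$ in the Bruhat order on $S_n$, $r=\ell(w)-\ell(v)$, and let $\Psi_{v,w}:\mathcal R^{>0}_{v,w}\to\mathbb R^r$ be the map sending the flag represented by $M_{v,w}(\mathbf a)$ to $\mathbf a$. Let $\mathcal E$ be the set of extremal indices of $P(M_{v,w}(\mathbf a))$ (which does not depend on $\mathbf a\in\mathbb R^r_{>0}$). Then each coordinate of $\Psi_{v,w}$ is a Laurent monomial in the extremal Plücker coordinates: for each $j\in[k]\setminus J$ there is a Laurent monomial $m_j$ in variables $(p_I)_{I\in\mathcal E}$ such that $a_j=m_j\big((P_I(M_{v,w}(\mathbf a)))_{I\in\mathcal E}\big)$ for all $\mathbf a\in\mathbb R^r_{>0}$.
   Context: Permutations: $s_i=(i,i+1)\in S_n$; $\ell$ is length; $\le$ the Bruhat order. Given a reduced expression $s_{i_1}\cdots s_{i_k}$ of $w$ and $v\le w$, a subexpression for $v$ is given by positions $j_1<\dots<j_m$ with $s_{i_{j_1}}\cdots s_{i_{j_m}}=v$; it is positive distinguished if it is reduced and for every position $p\notin\{j_1,\dots,j_m\}$, with $u_p$ the product of the $s_{i_{j_t}}$ with $j_t>p$ (in order), $\ell(s_{i_p}u_p)>\ell(u_p)$; such a subexpression exists and is unique. For $1\le k<n$, $x_k(a)$ is the identity with an extra entry $a$ in row $k$, column $k+1$; $\dot s_k$ is the identity with the block in rows/columns $\{k,k+1\}$ replaced by $\begin{pmatrix}0&1\\-1&0\end{pmatrix}$. Fix $w_0=(s_1\cdots s_{n-1})(s_1\cdots s_{n-2})\cdots(s_1s_2)(s_1)$.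 For $v\le w$, let $s_{i_1}\cdots s_{i_k}$ ($k=\ell(w)$) be the positive distinguished subexpression for $w$ in it, $J\subset[k]$ the positions of the positive distinguished subexpression for $v$ in it, and for $\mathbf a=(a_j)_{j\in[k]\setminus J}\in\mathbb R_{>0}^{r}$ put $M_{v,w}(\mathbf a)=M_1\cdots M_k$, $M_j=\dot s_{i_j}$ for $j\in J$, $M_j=x_{i_j}(a_j)$ otherwise. $\mathcal R^{>0}_{v,w}$ is the set of complete flags (first $i$ rows spanning $V_i$) represented by the matrices $M_{v,w}(\mathbf a)$, $\mathbf a\in\mathbb R^r_{>0}$; $\mathbf a\mapsto$ flag is injective. $P_I(M)$ is the determinant of the submatrix of $M$ in rows $\{1,\dots,|I|\}$ and columns $I$. Extremal indices: for $P=(P_I)$ with $I$ ranging over subsets with $1\le|I|\le n-1$, and $1\le k<n$, define $\Xi_P$ on $k$-subsets: if $P_I\ne0$, let $b$ be the largest $i\in I$ such that there is $j\notin I$, $j>i$, with $P_{(I\setminus\{i\})\cup\{j\}}\ne0$; if $b$ exists, let $a$ be the largest $j\notin I$ with $P_{(I\setminus\{b\})\cup\{j\}}\ne0$ and set $\Xi_P(I)=(I\setminus\{b\})\cup\{a\}$; otherwise ($P_I=0$ or no such $b$) $\Xi_P(I)=I$. The Gale order on $k$-subsets: $\{i_1<\dots<i_k\}\le\{j_1<\dots<j_k\}$ iff $i_t\le j_t$ for all $t$. Let $I_k$ be the Gale-minimal $k$-subset with $P_{I_k}\ne0$ (it exists and is unique when the nonzero indices form a matroid). The extremal indices of $P$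 are the subsets in the $\Xi_P$-orbit $\{I_k,\Xi_P(I_k),\Xi_P^2(I_k),\dots\}$ for some $k\in[n-1]$; the corresponding $P_I$ are the extremal (non-zero) Plücker coordinates. *)

theory Defs
  imports "HOL-Combinatorics.Permutations" "Jordan_Normal_Form.Determinant"
    "Jordan_Normal_Form.DL_Submatrix"
begin

text \<open>Conventions: everything is 0-indexed. S_n acts on {0..<n}; the simple
transposition s_i (0 <= i < n-1) swaps i and i+1 (paper's s_{i+1}).
The product of permutations is function composition.\<close>

definition stp :: "nat \<Rightarrow> nat \<Rightarrow> nat" where
  "stp i = (\<lambda>x. if x = i then Suc i else if x = Suc i then i else x)"

definition tsp :: "nat \<Rightarrow> nat \<Rightarrow> nat \<Rightarrow> nat" where
  "tsp a b = (\<lambda>x. if x = a then b else if x = b then a else x)"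

fun wprod :: "nat list \<Rightarrow> nat \<Rightarrow> nat" where
  "wprod [] = id"
| "wprod (i # is) = stp i \<circ> wprod is"

definition len :: "nat \<Rightarrow> (nat \<Rightarrow> nat) \<Rightarrow> nat" where
  "len n w = (LEAST k. \<exists>ws. length ws = k \<and> set ws \<subseteq> {..<n-1} \<and> wprod ws = w)"

definition bruhat_step :: "nat \<Rightarrow> (nat \<Rightarrow> nat) \<Rightarrow> (nat \<Rightarrow> nat) \<Rightarrow> bool" where
  "bruhat_step n u u' = (u permutes {..<n} \<and>
     (\<exists>a b. a < b \<and> b < n \<and> u' = u \<circ> tsp a b \<and> len n u < len n u'))"

definition bruhat_le :: "nat \<Rightarrow> (nat \<Rightarrow> nat) \<Rightarrow> (nat \<Rightarrow> nat) \<Rightarrow> bool" where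
  "bruhat_le n v w = (v permutes {..<n} \<and> w permutes {..<n} \<and> (bruhat_step n)\<^sup>*\<^sup>* v w)"

text \<open>The fixed reduced word of w_0: (s_1..s_{n-1})(s_1..s_{n-2})...(s_1), 0-indexed.\<close>
definition w0word :: "nat \<Rightarrow> nat list" where
  "w0word n = concat (map (\<lambda>m. [0..<m]) (rev [1..<n]))"

text \<open>Positive distinguished subexpression for v in the word ws, as a set of
(0-indexed) positions.\<close>
definition is_pds :: "nat \<Rightarrow> nat list \<Rightarrow> (nat \<Rightarrow> nat) \<Rightarrow> nat set \<Rightarrow> bool" where
  "is_pds n ws v J = (J \<subseteq> {..<length ws} \<and> wprod (nths ws J) = v \<and> len n v = card J \<and>
     (\<forall>p < length ws. p \<notin> J \<longrightarrow>
        len n (stp (ws ! p) \<circ> wprod (nths ws {j\<in>J. p < j})) > len n (wprod (nths ws {j\<in>J. p < j}))))"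

definition pds :: "nat \<Rightarrow> nat list \<Rightarrow> (nat \<Rightarrow> nat) \<Rightarrow> nat set" where
  "pds n ws v = (THE J. is_pds n ws v J)"

definition xmat :: "nat \<Rightarrow> nat \<Rightarrow> real \<Rightarrow> real mat" where
  "xmat n k a = mat n n (\<lambda>(i,j). if i = j then 1 else if i = k \<and> j = Suc k then a else 0)"

definition sdot :: "nat \<Rightarrow> nat \<Rightarrow> real mat" where
  "sdot n k = mat n n (\<lambda>(i,j).
     if i = k \<and> j = Suc k then 1 else if i = Suc k \<and> j = k then -1
     else if i = j \<and> i \<noteq> k \<and> i \<noteq> Suc k then 1 else 0)"

definition Mvw :: "nat \<Rightarrow> nat list \<Rightarrow> nat set \<Rightarrow> (nat \<Rightarrow> real) \<Rightarrow> real mat" where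
  "Mvw n ws J a = foldr (\<lambda>p M. (if p \<in> J then sdot n (ws ! p) else xmat n (ws ! p) (a p)) * M)
      [0..<length ws] (1\<^sub>m n)"

definition plucker :: "real mat \<Rightarrow> nat set \<Rightarrow> real" where
  "plucker M I = det (submatrix M {..<card I} I)"

definition Xi :: "nat \<Rightarrow> (nat set \<Rightarrow> real) \<Rightarrow> nat set \<Rightarrow> nat set" where
  "Xi n P I = (let B = {i \<in> I. \<exists>j<n. j \<notin> I \<and> i < j \<and> P (insert j (I - {i})) \<noteq> 0} in
     if P I \<noteq> 0 \<and> B \<noteq> {} then
       (let b = Max B; a = Max {j. j < n \<and> j \<notin> I \<and> P (insert j (I - {b})) \<noteq> 0}
        in insert a (I - {b}))
     else I)"

definition gale_le :: "nat set \<Rightarrow> nat set \<Rightarrow> bool" where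
  "gale_le I J = list_all2 (\<le>) (sorted_list_of_set I) (sorted_list_of_set J)"

definition Imin :: "nat \<Rightarrow> (nat set \<Rightarrow> real) \<Rightarrow> nat \<Rightarrow> nat set" where
  "Imin n P k = (THE I. I \<subseteq> {..<n} \<and> card I = k \<and> P I \<noteq> 0 \<and>
     (\<forall>J. J \<subseteq> {..<n} \<and> card J = k \<and> P J \<noteq> 0 \<longrightarrow> gale_le I J))"

definition extremal :: "nat \<Rightarrow> (nat set \<Rightarrow> real) \<Rightarrow> nat set set" where
  "extremal n P = {I. \<exists>k. 1 \<le> k \<and> k < n \<and> (\<exists>m. I = (Xi n P ^^ m) (Imin n P k))}"

end

theory Submission
  imports Defs
begin

text \<open>Up to commutations, the greedy word of \<open>w\<close> is a product of descending runs
  \<open>s\<^sub>m \<dots> s\<^sub>q\<close> with \<open>m = 1, \<dots>, n - 1\<close>. At level \<open>k\<close> the runs with \<open>m < k\<close> act on the first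
  \<open>k\<close> rows by a unimodular block and do not affect the Pluecker coordinates. Multiplying the
  remaining letters from the right keeps the first \<open>k\<close> rows in a shape with distinct leading and
  distinct trailing positions: a dotted letter only permutes leading positions (where the entries
  have absolute value 1), while trailing positions move to the right and their entries collect
  factors \<open>a\<^sub>j\<close>. The extremal indices of level \<open>k\<close> arise by replacing, from the right, the leading
  positions by the trailing ones, so quotients of consecutive extremal coordinates are the
  trailing entries up to sign. These are products of parameters from which all parameters can be
  solved, starting with the last run.

  Leading positions are controlled by a root-theoretic fact: in front of a dotted letter \<open>i\<close> the
  flag is stable under adding column \<open>i + 1\<close> to column \<open>i\<close>. The same fact shows that all minors
  are nonnegative, which fixes the signs and makes the set of nonzero coordinates independent of
  the parameters.\<close>

section \<open>Words, inversions and length\<close>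

text \<open>The reordering into descending runs makes the system of equations triangular. In
  ascending runs a letter can meet a trailing position already standing in the column it writes to.
  In a descending run each letter writes into a column just vacated or not yet reached, and the row
  trailing at \<open>i\<close> is moved by letter \<open>i\<close> alone: it collects exactly that
  one parameter before entering the later runs, whose parameters are already known. Level
  \<open>m + 1\<close> serves run \<open>m\<close> because its rows start in the columns
  \<open>0, ..., m\<close>, those that the letters of this run can move. Commutations change
  positions, so every letter carries its original position as a tag, which names its parameter and
  decides whether it is dotted. A separate obstacle is that \<open>pds\<close> is a definite
  description: nothing is known about \<open>J\<close> before existence and uniqueness are shown.
  The order is generated by length-increasing transpositions, so existence goes through rank
  numbers, for which the lifting property is a matter of counting.\<close>

lemma stp_simps [simp]: "stp i i = Suc i" "stp i (Suc i) = i" "stp i (stp i x) = x"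
  by (auto simp: stp_def)

lemma stp_other: "x \<noteq> i \<Longrightarrow> x \<noteq> Suc i \<Longrightarrow> stp i x = x"
  by (simp add: stp_def)

lemma stp_comp_stp [simp]: "stp i \<circ> stp i = id"
  by (rule ext) simp

lemma stp_eq_transpose: "stp i = transpose i (Suc i)"
  by (rule ext) (auto simp: stp_def transpose_def)

lemma stp_permutes: "Suc i < n \<Longrightarrow> stp i permutes {..<n}"
  unfolding stp_eq_transpose by (rule permutes_swap_id) auto

lemma inj_stp: "inj (stp i)"
  by (rule inj_on_inverseI[where g = "stp i"]) simp

lemma stp_commute: "Suc i < j \<or> Suc j < i \<Longrightarrow> stp i \<circ> stp j = stp j \<circ> stp i"
  by (rule ext) (auto simp: stp_def)

lemma stp_lessI: "x < y \<Longrightarrow> \<not> (x = i \<and> y = Suc i) \<Longrightarrow> stp i x < stp i y"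
  by (auto simp: stp_def)

declare wprod.simps [simp del]

lemma wprod_simps [simp]: "wprod [] = id" "wprod (i # ws) = stp i \<circ> wprod ws"
  by (simp_all add: wprod.simps fun_eq_iff)

text \<open>Left multiplication by a letter \<open>i\<close> exchanges two neighbouring values of
  the inverse permutation, so ascents are read off at the places \<open>i\<close> and
  \<open>Suc i\<close>.\<close>

primrec winv :: "nat list \<Rightarrow> nat \<Rightarrow> nat" where
  "winv [] = id"
| "winv (i # is) = winv is \<circ> stp i"

lemma winv_append: "winv (xs @ ys) = winv ys \<circ> winv xs"
  by (induction xs) (auto simp: o_assoc)

lemma winv_wprod [simp]: "winv ws (wprod ws x) = x"
  by (induction ws arbitrary: x) auto

lemma wprod_winv [simp]: "wprod ws (winv ws x) = x"
  by (induction ws arbitrary: x) auto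

lemma inv_wprod: "inv_into UNIV (wprod ws) = winv ws"
  by (rule inv_equality) simp_all

lemma wprod_eq_iff_winv_eq: "wprod xs = wprod ys \<longleftrightarrow> winv xs = winv ys"
proof
  assume "wprod xs = wprod ys" then show "winv xs = winv ys" by (metis inv_wprod)
next
  assume *: "winv xs = winv ys"
  show "wprod xs = wprod ys"
  proof
    fix x show "wprod xs x = wprod ys x" using wprod_winv[of xs "wprod ys x"] * by simp
  qed
qed

lemma wprod_eqI: "inv_into UNIV u = winv ws \<Longrightarrow> bij u \<Longrightarrow> wprod ws = u"
  by (rule ext) (metis bij_is_inj inv_f_f wprod_winv)

lemma wprod_permutes: "set ws \<subseteq> {..<n-1} \<Longrightarrow> wprod ws permutes {..<n}"
  by (induction ws) (auto intro!: permutes_compose stp_permutes)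

lemma inj_winv: "inj (winv ws)"
  by (rule inj_on_inverseI[where g = "wprod ws"]) simp

lemma winv_eq_iff [simp]: "winv ws x = winv ws y \<longleftrightarrow> x = y"
  by (rule inj_eq[OF inj_winv])

lemma winv_Suc_less_iff: "winv ws (Suc i) < winv ws i \<longleftrightarrow> \<not> winv ws i < winv ws (Suc i)"
  using winv_eq_iff[of ws i "Suc i"] by linarith

section \<open>Coxeter length as a number of inversions\<close>

definition inversions :: "nat \<Rightarrow> (nat \<Rightarrow> nat) \<Rightarrow> nat" where
  "inversions n t = card {(x,y). x < y \<and> y < n \<and> t y < t x}"

lemma finite_inversion_set [simp]: "finite {(x,y). x < y \<and> y < n \<and> t (y::nat) < (t x :: nat)}"
  by (rule finite_subset[of _ "{..<n} \<times> {..<n}"]) auto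

text \<open>Applying \<open>stp i\<close> to both coordinates preserves the order of every pair
  except \<open>(i, Suc i)\<close>, and this pair is the one new inversion.\<close>

lemma inversions_stp_asc:
  assumes "Suc i < n" "t i < t (Suc i)"
  shows "inversions n (t \<circ> stp i) = Suc (inversions n t)"
proof -
  let ?A = "{(x,y). x < y \<and> y < n \<and> t y < t x}"
  let ?B = "{(x,y). x < y \<and> y < n \<and> (t \<circ> stp i) y < (t \<circ> stp i) x}"
  have st: "y < n \<Longrightarrow> stp i y < n" for y using assms by (auto simp: stp_def)
  have "?B = insert (i, Suc i) (map_prod (stp i) (stp i) ` ?A)"
  proof (intro equalityI subsetI)
    fix z assume "z \<in> ?B"
    then obtain x y where z: "z = (x,y)" "x < y" "y < n" "t (stp i y) < t (stp i x)" by auto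
    show "z \<in> insert (i, Suc i) (map_prod (stp i) (stp i) ` ?A)"
    proof (cases "x = i \<and> y = Suc i")
      case False
      then have "(stp i x, stp i y) \<in> ?A" using z st stp_lessI by auto
      then have "map_prod (stp i) (stp i) (stp i x, stp i y) \<in> map_prod (stp i) (stp i) ` ?A" by (rule imageI)
      then show ?thesis using z by simp
    qed (use z in auto)
  next
    fix z assume "z \<in> insert (i, Suc i) (map_prod (stp i) (stp i) ` ?A)"
    then consider "z = (i, Suc i)" | x y where "z = (stp i x, stp i y)" "x < y" "y < n" "t y < t x"
      by auto
    then show "z \<in> ?B"
    proof cases
      case 1 then show ?thesis using assms by auto
    next
      case 2
      moreover have "\<not> (x = i \<and> y = Suc i)" using 2 assms by auto
      ultimately show ?thesis using stp_lessI st by auto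
    qed
  qed
  moreover have "(i, Suc i) \<notin> map_prod (stp i) (stp i) ` ?A"
    by (auto simp: stp_def split: if_splits)
  moreover have "inj_on (map_prod (stp i) (stp i)) ?A"
    by (rule inj_on_subset[OF map_prod_inj_on[OF inj_stp inj_stp]]) auto
  ultimately show ?thesis
    unfolding inversions_def by (simp add: card_image)
qed

lemma inversions_stp_desc:
  assumes "Suc i < n" "t (Suc i) < t i"
  shows "inversions n t = Suc (inversions n (t \<circ> stp i))"
  using inversions_stp_asc[of i n "t \<circ> stp i"] assms by (simp add: comp_assoc)

lemma increasing_permutes_id:
  assumes "t permutes {..<n}" "\<And>i. Suc i < n \<Longrightarrow> t i < (t (Suc i) :: nat)"
  shows "t = id"
proof -
  have "x < n \<Longrightarrow> x \<le> t x" for x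
  proof (induction x)
    case (Suc x)
    then show ?case using assms(2)[of x] by simp
  qed simp
  then show ?thesis using assms(1) by (intro permutes_natset_ge[of t "{..<n}"]) auto
qed

lemma inversions_id [simp]: "inversions n id = 0"
  by (auto simp: inversions_def card_eq_0_iff)

lemma inversions_winv_le: "set ws \<subseteq> {..<n-1} \<Longrightarrow> inversions n (winv ws) \<le> length ws"
proof (induction ws)
  case (Cons i ws)
  have i: "Suc i < n" using Cons.prems by auto
  have IH: "inversions n (winv ws) \<le> length ws" using Cons by simp
  show ?case
  proof (cases "winv ws i < winv ws (Suc i)")
    case True
    show ?thesis using inversions_stp_asc[OF i True] IH by (simp add: o_def)
  next
    case False
    then have d: "winv ws (Suc i) < winv ws i" by (simp add: winv_Suc_less_iff)
    show ?thesis using inversions_stp_desc[OF i d] IH by (simp add: o_def)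
  qed
qed simp

lemma reduced_word_exists:
  assumes "t permutes {..<n}"
  shows "\<exists>ws. set ws \<subseteq> {..<n-1} \<and> length ws = inversions n t \<and> winv ws = t"
  using assms
proof (induction "inversions n t" arbitrary: t rule: less_induct)
  case less
  show ?case
  proof (cases "\<exists>i. Suc i < n \<and> t (Suc i) < t i")
    case True
    then obtain i where i: "Suc i < n" "t (Suc i) < t i" by auto
    have s: "inversions n t = Suc (inversions n (t \<circ> stp i))" by (rule inversions_stp_desc[OF i])
    have "t \<circ> stp i permutes {..<n}"
      using less.prems stp_permutes[OF i(1)] by (rule permutes_compose[rotated])
    then obtain ws where ws: "set ws \<subseteq> {..<n-1}" "length ws = inversions n (t \<circ> stp i)" "winv ws = t \<circ> stp i"
      using less.hyps[of "t \<circ> stp i"] s by auto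
    have "winv (i # ws) = t" using ws(3) by (simp add: comp_assoc)
    then show ?thesis using ws(1,2) s i by (intro exI[of _ "i # ws"]) auto
  next
    case False
    have "t = id"
    proof (rule increasing_permutes_id[OF less.prems])
      fix i assume "Suc i < n"
      moreover have "t i \<noteq> t (Suc i)" using inj_eq[OF permutes_inj[OF less.prems]] by simp
      ultimately show "t i < t (Suc i)" using False by (metis linorder_neqE_nat)
    qed
    then show ?thesis by (intro exI[of _ "[]"]) simp
  qed
qed

lemma len_eq_inversions:
  assumes "u permutes {..<n}"
  shows "len n u = inversions n (inv_into UNIV u)"
proof -
  obtain ws where ws: "set ws \<subseteq> {..<n-1}" "length ws = inversions n (inv_into UNIV u)" "winv ws = inv_into UNIV u"
    using reduced_word_exists[OF permutes_inv[OF assms]] by blast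
  have "wprod ws = u" using wprod_eqI[of u ws] ws(3) permutes_bij[OF assms] by simp
  show ?thesis unfolding len_def
  proof (rule Least_equality)
    show "\<exists>ws. length ws = inversions n (inv_into UNIV u) \<and> set ws \<subseteq> {..<n-1} \<and> wprod ws = u"
      using ws \<open>wprod ws = u\<close> by blast
  next
    fix k assume "\<exists>ws. length ws = k \<and> set ws \<subseteq> {..<n-1} \<and> wprod ws = u"
    then show "inversions n (inv_into UNIV u) \<le> k" using inversions_winv_le inv_wprod by auto
  qed
qed

lemma len_wprod: "set ws \<subseteq> {..<n-1} \<Longrightarrow> len n (wprod ws) = inversions n (winv ws)"
  using len_eq_inversions[OF wprod_permutes] inv_wprod by simp

lemma len_stp_wprod:
  assumes "set ws \<subseteq> {..<n-1}" "Suc i < n"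
  shows "len n (wprod ws) < len n (stp i \<circ> wprod ws) \<longleftrightarrow> winv ws i < winv ws (Suc i)"
proof -
  have e: "len n (stp i \<circ> wprod ws) = inversions n (winv ws \<circ> stp i)"
    using len_wprod[of "i # ws" n] assms by auto
  have "inversions n (winv ws) < inversions n (winv ws \<circ> stp i) \<longleftrightarrow> winv ws i < winv ws (Suc i)"
  proof (cases "winv ws i < winv ws (Suc i)")
    case True
    then show ?thesis using inversions_stp_asc[OF assms(2) True] by simp
  next
    case False
    then have "winv ws (Suc i) < winv ws i" by (simp add: winv_Suc_less_iff)
    from inversions_stp_desc[OF assms(2) this] show ?thesis using False by simp
  qed
  then show ?thesis unfolding e len_wprod[OF assms(1)] .
qed

section \<open>Positive distinguished subexpressions\<close>

text \<open>A factorization is a list of pairs of a letter and the position it had in the original word;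
  the positions in \<open>J\<close> carry the dotted factors.\<close>
definition dword :: "nat set \<Rightarrow> (nat \<times> nat) list \<Rightarrow> nat list" where
  "dword J L = map fst (filter (\<lambda>l. snd l \<in> J) L)"

lemma dword_simps [simp]:
  "dword J [] = []"
  "dword J (l # L) = (if snd l \<in> J then fst l # dword J L else dword J L)"
  "dword J (L @ L') = dword J L @ dword J L'"
  by (simp_all add: dword_def)

lemma set_dword: "set (dword J L) \<subseteq> fst ` set L"
  by (auto simp: dword_def)

lemma dword_cong: "(\<And>l. l \<in> set L \<Longrightarrow> snd l \<in> J \<longleftrightarrow> snd l \<in> J') \<Longrightarrow> dword J L = dword J' L"
  unfolding dword_def by (metis (mono_tags, lifting) filter_cong)

text \<open>Every letter, dotted or not, must be an ascent of the dotted word to its right, which is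
  continued by \<open>us\<close>; \<open>winv\<close> is the inverse permutation, so no lengths occur.\<close>
primrec distinguished :: "nat list \<Rightarrow> nat set \<Rightarrow> (nat \<times> nat) list \<Rightarrow> bool" where
  "distinguished us J [] \<longleftrightarrow> True"
| "distinguished us J (l # L) \<longleftrightarrow> distinguished us J L \<and>
     winv (dword J L @ us) (fst l) < winv (dword J L @ us) (Suc (fst l))"

lemma distinguished_append: "distinguished us J (L @ L') \<longleftrightarrow> distinguished (dword J L' @ us) J L \<and> distinguished us J L'"
  by (induction L) auto

lemma distinguished_cong: "(\<And>l. l \<in> set L \<Longrightarrow> snd l \<in> J \<longleftrightarrow> snd l \<in> J') \<Longrightarrow> distinguished us J L = distinguished us J' L"
proof (induction L)
  case (Cons l L)
  have "dword J L = dword J' L" by (rule dword_cong) (use Cons.prems in auto)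
  then show ?case using Cons by simp
qed simp

text \<open>A letter exchanging the two places would be tested there by comparing
  \<open>winv us x\<close> with \<open>winv us y\<close>, and an inversion of \<open>us\<close>
  fails this test.\<close>

lemma distinguished_keeps_inversion:
  assumes "distinguished us J L" "x < y" "winv us y < winv us x"
  shows "wprod (dword J L) x < wprod (dword J L) y"
  using assms(1)
proof (induction L)
  case Nil
  then show ?case using assms by simp
next
  case (Cons l L)
  let ?u = "wprod (dword J L)"
  have IH: "?u x < ?u y" using Cons by simp
  have "\<not> (?u x = fst l \<and> ?u y = Suc (fst l))"
  proof
    assume *: "?u x = fst l \<and> ?u y = Suc (fst l)"
    then have "winv (dword J L) (fst l) = x" "winv (dword J L) (Suc (fst l)) = y"
      using winv_wprod[of "dword J L" x] winv_wprod[of "dword J L" y] by simp_all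
    then show False using Cons.prems assms by (simp add: winv_append)
  qed
  then show ?case using IH stp_lessI by simp
qed

text \<open>A letter that is an ascent with the suffix \<open>us\<close> and a descent without it
  would have exchanged a pair inverted by \<open>us\<close>, which is impossible. Hence prefixes
  remain distinguished although the condition looks to the right, and later inductions can append
  letters at the right end.\<close>

lemma distinguished_imp_distinguished_Nil: "distinguished us J L \<Longrightarrow> distinguished [] J L"
proof (induction L)
  case (Cons l L)
  let ?v = "winv (dword J L)"
  have "?v (fst l) < ?v (Suc (fst l))"
  proof (rule ccontr)
    assume "\<not> ?thesis"
    then have "?v (Suc (fst l)) < ?v (fst l)" by (simp add: winv_Suc_less_iff)
    from distinguished_keeps_inversion[OF _ this, of us J L] Cons.prems show False by (simp add: winv_append)
  qed
  then show ?case using Cons by simp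
qed simp

lemma distinguished_prefix: "distinguished [] J (L @ L') \<Longrightarrow> distinguished [] J L"
  using distinguished_imp_distinguished_Nil by (auto simp: distinguished_append)

text \<open>The permutation reveals the choice at the first letter: it is dotted iff the whole
  dotted word has a descent there. Cancelling it determines the permutation of the tail.\<close>

lemma distinguished_unique:
  assumes "distinguished [] J L" "distinguished [] J' L" "winv (dword J L) = winv (dword J' L)" "l \<in> set L"
  shows "snd l \<in> J \<longleftrightarrow> snd l \<in> J'"
  using assms
proof (induction L)
  case (Cons m L)
  have mark: "snd m \<in> K \<longleftrightarrow> winv (dword K (m # L)) (Suc (fst m)) < winv (dword K (m # L)) (fst m)"
    if "distinguished [] K (m # L)" for K using that by auto
  have eq: "snd m \<in> J \<longleftrightarrow> snd m \<in> J'"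
    using mark[OF Cons.prems(1)] mark[OF Cons.prems(2)] Cons.prems(3) by simp
  have "winv (dword J L) = winv (dword J' L)"
  proof (cases "snd m \<in> J")
    case True
    then have "winv (dword J L) \<circ> stp (fst m) = winv (dword J' L) \<circ> stp (fst m)"
      using Cons.prems(3) eq by (simp add: o_def)
    then have "winv (dword J L) \<circ> stp (fst m) \<circ> stp (fst m) = winv (dword J' L) \<circ> stp (fst m) \<circ> stp (fst m)"
      by simp
    then show ?thesis by (simp add: comp_assoc)
  qed (use Cons.prems(3) eq in simp)
  then show ?case using Cons eq by auto
qed simp

lemma distinguished_length:
  assumes "distinguished [] J L" "fst ` set L \<subseteq> {..<n-1}"
  shows "inversions n (winv (dword J L)) = length (dword J L)"
  using assms
proof (induction L)
  case (Cons l L)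
  then show ?case using inversions_stp_asc[of "fst l" n "winv (dword J L)"] by (auto simp: o_def)
qed simp

lemma distinguished_iff_nth:
  "distinguished us J L \<longleftrightarrow> (\<forall>p<length L. winv (dword J (drop (Suc p) L) @ us) (fst (L ! p))
                            < winv (dword J (drop (Suc p) L) @ us) (Suc (fst (L ! p))))"
proof (induction L)
  case (Cons l L)
  show ?case unfolding distinguished.simps Cons.IH by (auto simp: less_Suc_eq_0_disj)
qed simp

text \<open>A dotted letter at a descent would lower the inversion count, and the rest of the dotted
  word has at most as many inversions as letters, so the total could not reach the full
  length.\<close>

lemma reduced_imp_distinguished:
  assumes "fst ` set L \<subseteq> {..<n-1}" "inversions n (winv (dword J L)) = length (dword J L)"
    "\<And>p. p < length L \<Longrightarrow> snd (L ! p) \<notin> J \<Longrightarrow> winv (dword J (drop (Suc p) L)) (fst (L ! p))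
                            < winv (dword J (drop (Suc p) L)) (Suc (fst (L ! p)))"
  shows "distinguished [] J L"
  using assms
proof (induction L)
  case (Cons l L)
  let ?v = "winv (dword J L)"
  have i: "Suc (fst l) < n" using Cons.prems(1) by auto
  have sub: "set (dword J L) \<subseteq> {..<n-1}" using set_dword[of J L] Cons.prems(1) by auto
  have le: "inversions n ?v \<le> length (dword J L)" by (rule inversions_winv_le[OF sub])
  have "?v (fst l) < ?v (Suc (fst l)) \<and> inversions n ?v = length (dword J L)"
  proof (cases "snd l \<in> J")
    case True
    then have *: "inversions n (?v \<circ> stp (fst l)) = Suc (length (dword J L))" using Cons.prems(2) by (simp add: o_def)
    have "?v (fst l) < ?v (Suc (fst l))"
    proof (rule ccontr)
      assume "\<not> ?thesis"
      then have "?v (Suc (fst l)) < ?v (fst l)" by (simp add: winv_Suc_less_iff)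
      from inversions_stp_desc[OF i this] * le show False by simp
    qed
    then show ?thesis using inversions_stp_asc[OF i] * by auto
  next
    case False
    then show ?thesis using Cons.prems(2) Cons.prems(3)[of 0] by simp
  qed
  moreover have "distinguished [] J L" if "inversions n ?v = length (dword J L)"
  proof (rule Cons.IH[OF _ that])
    fix p assume "p < length L" "snd (L ! p) \<notin> J"
    then show "winv (dword J (drop (Suc p) L)) (fst (L ! p))
                            < winv (dword J (drop (Suc p) L)) (Suc (fst (L ! p)))"
      using Cons.prems(3)[of "Suc p"] by simp
  qed (use Cons.prems(1) in auto)
  ultimately show ?case by simp
qed simp

abbreviation tagged :: "nat list \<Rightarrow> (nat \<times> nat) list" where
  "tagged ws \<equiv> zip ws [0..<length ws]"

lemma nths_eq_dword: "nths ws J = dword J (tagged ws)"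
  by (simp add: nths_def dword_def)

lemma dword_drop_tagged:
  assumes "p < length ws"
  shows "nths ws {j \<in> J. p < j} = dword J (drop (Suc p) (tagged ws))"
proof -
  have "tagged ws = take (Suc p) (tagged ws) @ drop (Suc p) (tagged ws)" by simp
  then have "dword {j \<in> J. p < j} (tagged ws)
      = dword {j \<in> J. p < j} (take (Suc p) (tagged ws)) @ dword {j \<in> J. p < j} (drop (Suc p) (tagged ws))"
    by (metis dword_simps(3))
  moreover have "dword {j \<in> J. p < j} (take (Suc p) (tagged ws)) = dword {} (take (Suc p) (tagged ws))"
    by (rule dword_cong) (auto simp: in_set_conv_nth)
  moreover have "dword {j \<in> J. p < j} (drop (Suc p) (tagged ws)) = dword J (drop (Suc p) (tagged ws))"
    by (rule dword_cong) (auto simp: in_set_conv_nth)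
  moreover have "dword {} K = []" for K by (simp add: dword_def)
  ultimately show ?thesis by (simp add: nths_eq_dword)
qed

lemma is_pds_iff:
  assumes ws: "set ws \<subseteq> {..<n-1}"
  shows "is_pds n ws v J \<longleftrightarrow> J \<subseteq> {..<length ws} \<and> wprod (dword J (tagged ws)) = v \<and> distinguished [] J (tagged ws)"
proof -
  let ?L = "tagged ws"
  have fs: "fst ` set ?L \<subseteq> {..<n-1}" using ws by (auto dest: set_zip_leftD)
  have sub: "set (dword J K) \<subseteq> {..<n-1}" if "set K \<subseteq> set ?L" for K
    using set_dword[of J K] that fs by blast
  have cardJ: "card J = length (dword J ?L)" if "J \<subseteq> {..<length ws}"
  proof -
    have "{i. i < length ws \<and> i \<in> J} = J" using that by auto
    then show ?thesis using length_nths[of ws J] by (simp add: nths_eq_dword)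
  qed
  have cond: "len n (stp (ws ! p) \<circ> wprod (nths ws {j\<in>J. p < j})) > len n (wprod (nths ws {j\<in>J. p < j}))
     \<longleftrightarrow> winv (dword J (drop (Suc p) ?L)) (fst (?L ! p)) < winv (dword J (drop (Suc p) ?L)) (Suc (fst (?L ! p)))"
    if "p < length ws" for p
  proof -
    have "Suc (ws ! p) < n" using ws nth_mem[OF that] by (auto simp: subset_iff)
    then show ?thesis
      using len_stp_wprod[OF sub[OF set_drop_subset[of "Suc p" ?L]], of "ws ! p"] that dword_drop_tagged[OF that] by simp
  qed
  have len: "len n v = inversions n (winv (dword J ?L))" if "wprod (dword J ?L) = v"
    using len_wprod[OF sub[of ?L]] that by simp
  show ?thesis
  proof
    assume *: "is_pds n ws v J"
    have "distinguished [] J ?L"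
      by (rule reduced_imp_distinguished[OF fs])
         (use * cardJ cond len in \<open>auto simp: is_pds_def nths_eq_dword\<close>)
    then show "J \<subseteq> {..<length ws} \<and> wprod (dword J ?L) = v \<and> distinguished [] J ?L"
      using * by (simp add: is_pds_def nths_eq_dword)
  next
    assume *: "J \<subseteq> {..<length ws} \<and> wprod (dword J ?L) = v \<and> distinguished [] J ?L"
    have "len n v = card J" using * len cardJ distinguished_length[OF _ fs] by simp
    then show "is_pds n ws v J"
      using * cond by (auto simp: is_pds_def nths_eq_dword distinguished_iff_nth)
  qed
qed

lemma pds_eqI:
  assumes ws: "set ws \<subseteq> {..<n-1}" and J: "is_pds n ws v J"
  shows "pds n ws v = J"
  unfolding pds_def
proof (rule the_equality[where P = "is_pds n ws v", OF J])
  fix K assume K: "is_pds n ws v K"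
  have eq: "winv (dword K (tagged ws)) = winv (dword J (tagged ws))"
    using J K by (simp add: is_pds_iff[OF ws] flip: wprod_eq_iff_winv_eq)
  have "x \<in> K \<longleftrightarrow> x \<in> J" if "x < length ws" for x
    
  proof -
    have "(ws ! x, x) \<in> set (tagged ws)" using that by (force simp: in_set_zip)
    then show ?thesis using distinguished_unique[OF _ _ eq, of "(ws ! x, x)"] J K
      by (simp add: is_pds_iff[OF ws])
  qed
  then show "K = J" using J K by (auto simp: is_pds_iff[OF ws])
qed

section \<open>Bruhat order and existence of subexpressions\<close>

text \<open>The rank numbers of the tableau criterion for the Bruhat order.\<close>

definition rank_count :: "(nat \<Rightarrow> nat) \<Rightarrow> nat \<Rightarrow> nat \<Rightarrow> nat" where
  "rank_count u p q = card {j. j < p \<and> q \<le> u j}"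

lemma rank_count_Suc:
  "rank_count (wprod ws) p i = rank_count (wprod ws) p (Suc i) + of_bool (winv ws i < p)"
proof -
  have eq: "wprod ws j = i \<longleftrightarrow> j = winv ws i" for j using winv_wprod[of ws j] wprod_winv[of ws i] by metis
  have "{j. j < p \<and> i \<le> wprod ws j} = {j. j < p \<and> Suc i \<le> wprod ws j} \<union> (if winv ws i < p then {winv ws i} else {})"
    by (auto simp: Suc_le_eq le_less eq[symmetric])
  moreover have "{j. j < p \<and> Suc i \<le> wprod ws j} \<inter> (if winv ws i < p then {winv ws i} else {}) = {}"
    by auto
  ultimately show ?thesis unfolding rank_count_def by (auto simp: card_Un_disjoint)
qed

lemma rank_count_stp_other:
  assumes "q \<noteq> Suc i"
  shows "rank_count (stp i \<circ> u) p q = rank_count u p q"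
proof -
  have "q \<le> stp i x \<longleftrightarrow> q \<le> x" for x using assms by (auto simp: stp_def)
  then show ?thesis by (simp add: rank_count_def)
qed

definition rank_count_le :: "(nat \<Rightarrow> nat) \<Rightarrow> (nat \<Rightarrow> nat) \<Rightarrow> bool" where
  "rank_count_le u w \<longleftrightarrow> (\<forall>p q. rank_count u p q \<le> rank_count w p q)"

text \<open>Both cases of the lifting property: only the ranks at level \<open>Suc i\<close> change, and they are
  controlled by the ranks at the two neighbouring levels.\<close>
lemma rank_count_le_lifting:
  assumes le: "rank_count_le (wprod xs) (wprod (i # ws))" and w: "winv ws i < winv ws (Suc i)"
  shows "winv xs (Suc i) < winv xs i \<Longrightarrow> rank_count_le (wprod (i # xs)) (wprod ws)"
    and "winv xs i < winv xs (Suc i) \<Longrightarrow> rank_count_le (wprod xs) (wprod ws)"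
proof -
  have le_other: "rank_count (wprod xs) p q \<le> rank_count (wprod ws) p q" if "q \<noteq> Suc i" for p q
    using le rank_count_stp_other[OF that, of "wprod ws" p] unfolding rank_count_le_def wprod_simps by metis
  have lo: "rank_count (wprod zs) p i = rank_count (wprod zs) p (Suc (Suc i)) + of_bool (winv zs (Suc i) < p) + of_bool (winv zs i < p)"
    and mid: "rank_count (wprod zs) p (Suc i) = rank_count (wprod zs) p (Suc (Suc i)) + of_bool (winv zs (Suc i) < p)" for zs p
    using rank_count_Suc[of zs p i] rank_count_Suc[of zs p "Suc i"] by simp_all
  show "rank_count_le (wprod (i # xs)) (wprod ws)" if x: "winv xs (Suc i) < winv xs i"
  proof -
    have "rank_count (wprod (i # xs)) p q \<le> rank_count (wprod ws) p q" for p q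
    proof (cases "q = Suc i")
      case True
      have "rank_count (wprod (i # xs)) p (Suc (Suc i)) = rank_count (wprod xs) p (Suc (Suc i))"
        using rank_count_stp_other[of "Suc (Suc i)" i "wprod xs" p] by simp
      then show ?thesis
        unfolding True using mid[of "i # xs" p] mid[of ws p] lo[of xs p] lo[of ws p] x w
          le_other[of i p] le_other[of "Suc (Suc i)" p]
        by (auto simp: of_bool_def split: if_splits)
    next
      case False
      then show ?thesis using le_other[OF False] rank_count_stp_other[OF False, of "wprod xs" p] by simp
    qed
    then show ?thesis by (simp only: rank_count_le_def) blast
  qed
  show "rank_count_le (wprod xs) (wprod ws)" if x: "winv xs i < winv xs (Suc i)"
  proof -
    have "rank_count (wprod xs) p q \<le> rank_count (wprod ws) p q" for p q
    proof (cases "q = Suc i")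
      case True
      show ?thesis
        unfolding True using mid[of xs p] mid[of ws p] lo[of xs p] lo[of ws p] x w
          le_other[of i p] le_other[of "Suc (Suc i)" p]
        by (auto simp: of_bool_def split: if_splits)
    qed (rule le_other)
    then show ?thesis by (simp only: rank_count_le_def) blast
  qed
qed

lemma rank_count_le_id:
  assumes "u permutes {..<n}" "rank_count_le u id"
  shows "u = id"
proof (rule permutes_natset_le[OF assms(1)])
  have "u z \<le> z" for z
  proof -
    have "rank_count id (Suc z) (Suc z) = 0" by (auto simp: rank_count_def card_eq_0_iff)
    then have "rank_count u (Suc z) (Suc z) = 0" using assms(2) unfolding rank_count_le_def by (metis le_zero_eq)
    then show "u z \<le> z" by (auto simp: rank_count_def card_eq_0_iff)
  qed
  then show "\<forall>z\<in>{..<n}. u z \<le> z" by blast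
qed

text \<open>Greedy from the left: a letter is dotted exactly when it is a descent of the current
  target, and the corresponding case of the lifting property passes the comparison on to the tail.
  The target is given as a word so that its inverse is available as \<open>winv\<close>.\<close>

lemma subword_exists:
  assumes "fst ` set L \<subseteq> {..<n-1}" "distinguished [] UNIV L" "distinct (map snd L)"
    "set xs \<subseteq> {..<n-1}" "rank_count_le (wprod xs) (wprod (map fst L))"
  shows "\<exists>J. J \<subseteq> snd ` set L \<and> distinguished [] J L \<and> wprod (dword J L) = wprod xs"
  using assms
proof (induction L arbitrary: xs)
  case Nil
  have "wprod xs = wprod []"
    using rank_count_le_id[OF wprod_permutes[OF Nil.prems(4)]] Nil.prems(5) unfolding wprod_simps list.map .
  then show ?case by simp
next
  case (Cons l L)
  let ?i = "fst l"
  have dU: "dword UNIV L = map fst L" by (simp add: dword_def)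
  have w: "winv (map fst L) ?i < winv (map fst L) (Suc ?i)" using Cons.prems(2) by (simp add: dU)
  have le: "rank_count_le (wprod xs) (wprod (?i # map fst L))" using Cons.prems(5) by (simp only: list.map)
  have prems: "fst ` set L \<subseteq> {..<n-1}" "distinguished [] UNIV L" "distinct (map snd L)" using Cons.prems by auto
  have l: "snd l \<notin> snd ` set L" using Cons.prems(3) by auto
  show ?case
  proof (cases "winv xs ?i < winv xs (Suc ?i)")
    case True
    obtain J where J: "J \<subseteq> snd ` set L" "distinguished [] J L" "wprod (dword J L) = wprod xs"
      using Cons.IH[OF prems Cons.prems(4) rank_count_le_lifting(2)[OF le w True]] by blast
    have "winv (dword J L) = winv xs" using J(3) by (simp add: wprod_eq_iff_winv_eq)
    then have "distinguished [] J (l # L)" "wprod (dword J (l # L)) = wprod xs" using J l True by auto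
    then show ?thesis using J(1) by (intro exI[of _ J]) auto
  next
    case False
    then have d: "winv xs (Suc ?i) < winv xs ?i" by (simp add: winv_Suc_less_iff)
    have xs': "set (?i # xs) \<subseteq> {..<n-1}" using Cons.prems(1,4) by auto
    obtain J where J: "J \<subseteq> snd ` set L" "distinguished [] J L" "wprod (dword J L) = wprod (?i # xs)"
      using Cons.IH[OF prems xs' rank_count_le_lifting(1)[OF le w d]] by blast
    let ?J = "insert (snd l) J"
    have same: "snd m \<in> ?J \<longleftrightarrow> snd m \<in> J" if "m \<in> set L" for m using l that by (metis imageI insert_iff)
    have "dword ?J L = dword J L" "distinguished [] ?J L = distinguished [] J L"
      by (rule dword_cong distinguished_cong, erule same)+
    moreover have "winv (dword J L) = winv (?i # xs)" using J(3) by (simp only: wprod_eq_iff_winv_eq)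
    ultimately have "distinguished [] ?J (l # L)" "wprod (dword ?J (l # L)) = wprod xs"
      using J d by (auto simp: fun_eq_iff)
    then show ?thesis using J(1) by (intro exI[of _ ?J]) auto
  qed
qed

lemma rank_count_tsp_mono:
  assumes "a < b" "u a \<le> u b"
  shows "rank_count_le u (u \<circ> tsp a b)" 
  unfolding rank_count_le_def
proof (intro allI)
  fix p q
  let ?A = "{j. j < p \<and> q \<le> u j}" and ?B = "{j. j < p \<and> q \<le> u (tsp a b j)}"
  \<comment> \<open>If both positions lie below \<open>p\<close>, the transposition permutes the
    positions below \<open>p\<close>. Otherwise the second branch is the identity: below
    \<open>p\<close> at most the value at \<open>a\<close> changes, and it does not
    decrease.\<close>
  let ?f = "\<lambda>j. if b < p then tsp a b j else if j = a then a else j"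
  have "card ?A \<le> card ?B"
  proof (rule card_inj_on_le)
    show "inj_on ?f ?A" by (auto simp: inj_on_def tsp_def)
    show "?f ` ?A \<subseteq> ?B"
    proof (rule image_subsetI)
      fix j assume "j \<in> ?A"
      then have "j < p" "q \<le> u j" by auto
      then show "?f j \<in> ?B" using assms by (cases "b < p") (auto simp: tsp_def)
    qed
  qed simp
  then show "rank_count u p q \<le> rank_count (u \<circ> tsp a b) p q" by (simp add: rank_count_def)
qed

lemma rank_count_tsp_antimono:
  assumes "a < b" "u b \<le> u a"
  shows "rank_count_le (u \<circ> tsp a b) u"
proof -
  have "u \<circ> tsp a b \<circ> tsp a b = u" by (auto simp: tsp_def fun_eq_iff)
  then show ?thesis using rank_count_tsp_mono[OF assms(1), of "u \<circ> tsp a b"] assms by (simp add: tsp_def)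
qed

lemma distinguished_UNIV_reduced:
  assumes "fst ` set L \<subseteq> {..<n-1}" "inversions n (winv (map fst L)) = length L"
  shows "distinguished [] UNIV L"
  by (rule reduced_imp_distinguished[OF assms(1)]) (use assms(2) in \<open>simp_all add: dword_def\<close>)

lemma permutes_wprodE:
  assumes "u permutes {..<n}"
  obtains ws where "set ws \<subseteq> {..<n-1}" "length ws = len n u" "wprod ws = u"
proof -
  obtain ws where ws: "set ws \<subseteq> {..<n-1}" "length ws = inversions n (inv_into UNIV u)" "winv ws = inv_into UNIV u"
    using reduced_word_exists[OF permutes_inv[OF assms]] by blast
  have "wprod ws = u" using wprod_eqI[of u ws] ws(3) permutes_bij[OF assms] by simp
  then show ?thesis using that[OF ws(1)] ws(2) len_eq_inversions[OF assms] by simp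
qed

text \<open>A reduced word of \<open>w\<close> contains a reduced word of \<open>u\<close>. This
  forces a length-increasing transposition to raise the rank numbers, not lower them.\<close>

lemma rank_count_le_imp_len_le:
  assumes u: "u permutes {..<n}" and w: "w permutes {..<n}" and le: "rank_count_le u w"
  shows "len n u \<le> len n w"
proof -
  obtain xs where xs: "set xs \<subseteq> {..<n-1}" "wprod xs = u" using permutes_wprodE[OF u] by metis
  obtain ws where ws: "set ws \<subseteq> {..<n-1}" "length ws = len n w" "wprod ws = w" using permutes_wprodE[OF w] by metis
  let ?L = "tagged ws"
  have L: "fst ` set ?L \<subseteq> {..<n-1}" "distinct (map snd ?L)" using ws(1) by (auto dest: set_zip_leftD)
  have "inversions n (winv (map fst ?L)) = length ?L"
    using len_wprod[OF ws(1)] ws(2,3) by simp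
  then have PDU: "distinguished [] UNIV ?L" by (rule distinguished_UNIV_reduced[OF L(1)])
  obtain J where J: "distinguished [] J ?L" "wprod (dword J ?L) = u"
    using subword_exists[OF L(1) PDU L(2) xs(1)] le xs(2) ws(3) by auto
  have sub: "set (dword J ?L) \<subseteq> {..<n-1}" using set_dword[of J ?L] L(1) by blast
  have "len n u = length (dword J ?L)" using len_wprod[OF sub] distinguished_length[OF J(1) L(1)] J(2) by simp
  also have "\<dots> \<le> length ?L" unfolding dword_def length_map by (rule length_filter_le)
  finally show ?thesis using ws(2) by simp
qed

lemma tsp_permutes: "a < n \<Longrightarrow> b < n \<Longrightarrow> tsp a b permutes {..<n}"
proof -
  assume "a < n" "b < n"
  moreover have "tsp a b = transpose a b" by (auto simp: tsp_def transpose_def fun_eq_iff)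
  ultimately show ?thesis using permutes_swap_id[of a "{..<n}" b] by simp
qed

lemma bruhat_step_rank_count_le:
  assumes "bruhat_step n u u'"
  shows "rank_count_le u u'"
proof -
  from assms obtain a b where ab: "a < b" "b < n" "u' = u \<circ> tsp a b" "len n u < len n u'" "u permutes {..<n}"
    by (auto simp: bruhat_step_def)
  have u': "u' permutes {..<n}" unfolding ab(3) using ab tsp_permutes[of a n b] by (auto intro: permutes_compose)
  have "u a \<le> u b"
  proof (rule ccontr)
    assume "\<not> u a \<le> u b"
    then have "rank_count_le u' u" using rank_count_tsp_antimono[OF ab(1), of u] ab(3) by simp
    from rank_count_le_imp_len_le[OF u' ab(5) this] ab(4) show False by simp
  qed
  then show ?thesis using rank_count_tsp_mono[OF ab(1)] ab(3) by simp
qed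

lemma bruhat_le_imp_rank_count_le:
  assumes "bruhat_le n v w" shows "rank_count_le v w"
proof -
  have "(bruhat_step n)\<^sup>*\<^sup>* v w" using assms by (simp add: bruhat_le_def)
  then show ?thesis
  proof induction
    case (step y z)
    then show ?case using bruhat_step_rank_count_le[OF step.hyps(2)] unfolding rank_count_le_def by (meson order_trans)
  qed (simp add: rank_count_le_def)
qed

lemma is_pds_exists:
  assumes ws: "set ws \<subseteq> {..<n-1}" "distinguished [] UNIV (tagged ws)"
    and v: "bruhat_le n v (wprod ws)"
  shows "\<exists>J. is_pds n ws v J"
proof -
  let ?L = "tagged ws"
  have L: "fst ` set ?L \<subseteq> {..<n-1}" "distinct (map snd ?L)" using ws(1) by (auto dest: set_zip_leftD)
  have "v permutes {..<n}" using v by (simp add: bruhat_le_def)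
  then obtain xs where xs: "set xs \<subseteq> {..<n-1}" "wprod xs = v" using permutes_wprodE by metis
  obtain J where J: "J \<subseteq> snd ` set ?L" "distinguished [] J ?L" "wprod (dword J ?L) = v"
    using subword_exists[OF L(1) ws(2) L(2) xs(1)] bruhat_le_imp_rank_count_le[OF v] xs(2) by auto
  have "snd ` set ?L \<subseteq> {..<length ws}" by (auto dest: set_zip_rightD)
  then have "is_pds n ws v J" unfolding is_pds_iff[OF ws(1)] using J by (intro conjI) auto
  then show ?thesis ..
qed

section \<open>The chosen reduced word of the longest element up to commutations\<close>

text \<open>The map \<open>f\<close> extracts the letter, so one relation covers plain words and
  tagged lists, and a commutation of words lifts to the tags.\<close>

inductive comm :: "('a \<Rightarrow> nat) \<Rightarrow> 'a list \<Rightarrow> 'a list \<Rightarrow> bool" for f where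
  same [simp]: "comm f xs xs"
| swap: "comm f xs (us @ [a, b] @ vs) \<Longrightarrow> Suc (f a) < f b \<or> Suc (f b) < f a \<Longrightarrow> comm f xs (us @ [b, a] @ vs)"

abbreviation wcomm :: "nat list \<Rightarrow> nat list \<Rightarrow> bool" where
  "wcomm \<equiv> comm (\<lambda>x. x)"

lemma comm_trans:
  assumes "comm f xs ys" "comm f ys zs"
  shows "comm f xs zs"
  using assms(2,1)
proof (induction rule: comm.induct)
  case (swap ys us a b vs)
  then show ?case using comm.swap[of f xs us a b vs] by blast
qed

lemma comm_context:
  assumes "comm f xs ys"
  shows "comm f (us @ xs @ vs) (us @ ys @ vs)"
  using assms
proof induction
  case (swap xs us' a b vs')
  then show ?case using comm.swap[of f "us @ xs @ vs" "us @ us'" a b "vs' @ vs"] by simp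
qed simp

lemma comm_move:
  "(\<And>b. b \<in> set ys \<Longrightarrow> Suc (f a) < f b \<or> Suc (f b) < f a) \<Longrightarrow> comm f (a # ys) (ys @ [a])"
proof (induction ys)
  case (Cons b ys)
  have "comm f (a # b # ys) (b # a # ys)"
    using comm.swap[of f "a # b # ys" "[]" a b ys] Cons.prems[of b] by simp
  moreover have "comm f (b # a # ys) (b # ys @ [a])"
    using comm_context[OF Cons.IH, of "[b]" "[]"] Cons.prems by simp
  ultimately show ?case using comm_trans by fastforce
qed simp

lemma comm_mset: "comm f xs ys \<Longrightarrow> mset xs = mset ys"
  by (induction rule: comm.induct) auto

lemma comm_lift:
  assumes "wcomm xs ys" "xs = map f L"
  shows "\<exists>L'. comm f L L' \<and> map f L' = ys"
  using assms
proof induction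
  case same
  then show ?case by (intro exI[of _ L]) simp
next
  case (swap xs us a b vs)
  then obtain L' where L': "comm f L L'" "map f L' = us @ [a, b] @ vs" by auto
  from L'(2) obtain U a' b' V where "L' = U @ [a', b'] @ V" "map f U = us" "f a' = a" "f b' = b" "map f V = vs"
    by (auto simp: map_eq_append_conv map_eq_Cons_conv)
  then show ?case using comm.swap[of f L U a' b' V] L'(1) swap.hyps(2)
    by (intro exI[of _ "U @ [b', a'] @ V"]) auto
qed

lemma comm_filter:
  assumes "comm f L L'"
  shows "comm f (filter P L) (filter P L')"
  using assms
proof induction
  case (swap xs us a b vs)
  then show ?case using comm.swap[of f "filter P xs" "filter P us" a b "filter P vs"] by auto
qed simp

lemma comm_map: "comm f L L' \<Longrightarrow> wcomm (map f L) (map f L')"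
proof (induction rule: comm.induct)
  case (swap xs us a b vs)
  then show ?case using comm.swap[of "\<lambda>x. x" "map f xs" "map f us" "f a" "f b" "map f vs"] by simp
qed simp

lemma comm_dword: "comm fst L L' \<Longrightarrow> wcomm (dword J L) (dword J L')"
  unfolding dword_def by (rule comm_map, rule comm_filter)

lemma comm_winv: "wcomm xs ys \<Longrightarrow> winv xs = winv ys"
proof (induction rule: comm.induct)
  case (swap xs us a b vs)
  then have "stp a \<circ> stp b = stp b \<circ> stp a" by (intro stp_commute) auto
  then have "winv [a, b] = winv [b, a]" by (simp add: fun_eq_iff)
  then show ?case using swap.IH by (simp only: winv_append)
qed simp

lemma distinguished_winv_cong: "winv us = winv us' \<Longrightarrow> distinguished us J L = distinguished us' J L"
  by (induction L) (auto simp: winv_append)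

text \<open>Of two commuting letters, neither moves the places at which the other is tested.\<close>

lemma distinguished_comm:
  assumes "comm fst L L'"
  shows "distinguished us J L = distinguished us J L'"
  using assms
proof induction
  case (swap xs A a b B)
  let ?U = "dword J B @ us"
  have eq: "winv (dword J [a, b] @ ?U) = winv (dword J [b, a] @ ?U)"
  proof -
    have "comm fst [a, b] [b, a]" using comm.swap[of fst "[a, b]" "[]" a b "[]"] swap.hyps(2) by simp
    from comm_winv[OF comm_dword[OF this]] show ?thesis by (simp only: winv_append)
  qed
  have two: "distinguished ?U J [a, b] = distinguished ?U J [b, a]"
    using swap.hyps(2) by (auto simp: stp_other)
  have "distinguished us J (A @ [a, b] @ B) = distinguished us J (A @ [b, a] @ B)"
    unfolding distinguished_append[of us] distinguished_append[of ?U J "[a, b]"] distinguished_append[of _ J A] 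
    using distinguished_winv_cong[OF eq, of J A] two by (simp only: distinguished_append dword_simps(3) append_assoc)
  then show ?case using swap.IH by simp
qed simp

lemma w0word_Suc: "w0word (Suc n) = [0..<n] @ w0word n"
  by (cases n) (simp_all add: w0word_def)

lemma set_w0word: "set (w0word n) \<subseteq> {..<n-1}"
proof (induction n)
  case 0
  show ?case by (simp add: w0word_def)
qed (auto simp: w0word_Suc)

definition groups :: "(nat \<Rightarrow> nat) \<Rightarrow> nat \<Rightarrow> nat list" where
  "groups q m = concat (map (\<lambda>j. rev [q j..<Suc j]) [0..<m])"

lemma groups_0 [simp]: "groups q 0 = []" and groups_Suc: "groups q (Suc m) = groups q m @ rev [q m..<Suc m]"
  by (simp_all add: groups_def)

lemma groups_cong: "(\<And>j. j < m \<Longrightarrow> q j = q' j) \<Longrightarrow> groups q m = groups q' m"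
  unfolding groups_def by (rule arg_cong[where f = concat]) auto

text \<open>The last letter of the leading ascending run commutes with everything in
  \<open>w0word n\<close>, whose letters are below \<open>n - 1\<close>; moved to the right, it
  becomes the head of the descending run.\<close>

lemma comm_w0word_Suc: "wcomm (w0word (Suc n)) (w0word n @ rev [0..<n])"
proof (induction n)
  case 0
  show ?case by (simp add: w0word_def)
next
  case (Suc n)
  have "wcomm ([0..<Suc n] @ w0word (Suc n)) ([0..<Suc n] @ w0word n @ rev [0..<n])"
    using comm_context[OF Suc.IH, of "[0..<Suc n]" "[]"] by simp
  moreover have "wcomm (n # w0word n) (w0word n @ [n])"
    by (rule comm_move) (use set_w0word[of n] in auto)
  then have "wcomm ([0..<n] @ (n # w0word n) @ rev [0..<n]) ([0..<n] @ (w0word n @ [n]) @ rev [0..<n])"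
    by (rule comm_context)
  ultimately show ?case using comm_trans by (fastforce simp: w0word_Suc)
qed

lemma comm_w0word_groups: "wcomm (w0word n) (groups (\<lambda>_. 0) (n - 1))"
proof (induction n)
  case 0
  show ?case by (simp add: w0word_def)
next
  case (Suc n)
  show ?case
  proof (cases n)
    case 0
    then show ?thesis by (simp add: w0word_def)
  next
    case (Suc m)
    have "wcomm (w0word n @ rev [0..<n]) (groups (\<lambda>_. 0) (n - 1) @ rev [0..<n])"
      using comm_context[OF Suc.IH, of "[]" "rev [0..<n]"] by simp
    then show ?thesis using comm_trans[OF comm_w0word_Suc] Suc by (simp add: groups_Suc)
  qed
qed

lemma winv_rev_upt:
  "q \<le> k \<Longrightarrow> winv (rev [q..<k]) x = (if x < q then x else if x < k then Suc x else if x = k then q else x)"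
proof (induction k arbitrary: x)
  case (Suc k)
  show ?case
  proof (cases "q = Suc k")
    case False
    then show ?thesis using Suc by (auto simp: stp_def)
  qed (use Suc in auto)
qed auto

lemma winv_increasing:
  assumes "\<And>i. i < m \<Longrightarrow> winv us i < winv us (Suc i)" "x < y" "y \<le> m"
  shows "winv us x < winv us y"
  using assms(2,3)
proof (induction y)
  case (Suc y)
  show ?case
  proof (cases "x = y")
    case True then show ?thesis using assms(1)[of y] Suc by simp
  next
    case False
    then show ?thesis using Suc assms(1)[of y] by simp
  qed
qed simp

text \<open>At letter \<open>j\<close> the dotted word so far is the run from \<open>j - 1\<close>
  down to \<open>q\<close>, or empty. The test therefore compares the value of
  \<open>winv us\<close> at \<open>q\<close> or at \<open>j\<close> with that at
  \<open>Suc j\<close>, and \<open>winv us\<close> is increasing there.\<close>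

lemma distinguished_group:
  assumes "map fst G = rev [0..<k]" "\<And>l. l \<in> set G \<Longrightarrow> snd l \<in> J \<longleftrightarrow> q \<le> fst l"
    "\<And>i. i < k \<Longrightarrow> winv us i < winv us (Suc i)"
  shows "distinguished us J G \<and> dword J G = rev [q..<k]"
  using assms
proof (induction k arbitrary: G)
  case (Suc k)
  from Suc.prems(1) obtain l G' where G: "G = l # G'" "fst l = k" "map fst G' = rev [0..<k]"
    by (auto simp: map_eq_Cons_conv)
  have IH: "distinguished us J G'" "dword J G' = rev [q..<k]" using Suc.IH[OF G(3)] Suc.prems(2,3) G(1) by auto
  have lJ: "snd l \<in> J \<longleftrightarrow> q \<le> k" using Suc.prems(2)[of l] G by auto
  have "winv us (if q \<le> k then q else k) < winv us (Suc k)"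
    by (rule winv_increasing[of "Suc k"]) (use Suc.prems(3) in auto)
  then have "winv (dword J G' @ us) k < winv (dword J G' @ us) (Suc k)"
    unfolding IH(2) by (cases "q \<le> k") (auto simp: winv_append winv_rev_upt)
  then show ?case using G IH lJ by auto
qed simp

lemma greedy_groups:
  assumes "map fst L = groups (\<lambda>_. 0) m" "distinct (map snd L)" "t permutes {..<Suc m}"
    "\<And>i. i < m \<Longrightarrow> winv us i < winv us (Suc i)"
  shows "\<exists>J q. J \<subseteq> snd ` set L \<and> distinguished us J L \<and> winv (dword J L) = t \<and> dword J L = groups q m"
  using assms
proof (induction m arbitrary: L t us)
  case 0
  then have "t = id" by (metis lessThan_0 lessThan_Suc permutes_sing)
  then show ?case using 0 by auto
next
  case (Suc m)
  from Suc.prems(1) obtain L1 G where L: "L = L1 @ G" "map fst L1 = groups (\<lambda>_. 0) m" "map fst G = rev [0..<Suc m]"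
    unfolding groups_Suc map_eq_append_conv by metis
  \<comment> \<open>The earlier runs fix \<open>Suc m\<close>, so the image of \<open>Suc m\<close>
    under \<open>t\<close> is its image under the last run alone, namely the lower end of that run.
    The value \<open>Suc m\<close> stands for the empty run.\<close>
  define q where "q = t (Suc m)"
  have q: "q \<le> Suc m" using permutes_in_image[OF Suc.prems(3), of "Suc m"] by (auto simp: q_def)
  let ?y = "rev [q..<Suc m]"
  define JG where "JG = snd ` {l \<in> set G. q \<le> fst l}"
  have dG: "distinct (map snd G)" and d1: "distinct (map snd L1)" and disj: "snd ` set L1 \<inter> snd ` set G = {}"
    using Suc.prems(2) L(1) by auto
  have JGiff: "snd l \<in> JG \<longleftrightarrow> q \<le> fst l" if "l \<in> set G" for l
    using that dG unfolding JG_def distinct_map inj_on_def by auto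
  have us: "\<And>i. i < Suc m \<Longrightarrow> winv us i < winv us (Suc i)" by (rule Suc.prems(4))
  have G: "distinguished us JG G" "dword JG G = ?y"
    using distinguished_group[OF L(3) JGiff us] by auto
  let ?t = "wprod ?y \<circ> t"
  have "set ?y \<subseteq> {..<Suc (Suc m) - 1}" by auto
  then have "?t permutes {..<Suc (Suc m)}" using permutes_compose[OF Suc.prems(3) wprod_permutes] by blast
  moreover have "winv ?y (Suc m) = q" unfolding winv_rev_upt[OF q] using q by simp
  then have "?t (Suc m) = Suc m"
    using wprod_winv[of ?y "Suc m"] unfolding o_apply q_def[symmetric] by (simp only:)
  ultimately have t': "?t permutes {..<Suc m}"
    by (elim permutes_superset) (auto simp: less_Suc_eq)
  have us': "winv (?y @ us) i < winv (?y @ us) (Suc i)" if "i < m" for i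
    unfolding winv_append o_apply winv_rev_upt[OF q]
    by (rule winv_increasing[OF us]) (use that q in auto)
  obtain J1 r where J1: "J1 \<subseteq> snd ` set L1" "distinguished (?y @ us) J1 L1" "winv (dword J1 L1) = ?t" "dword J1 L1 = groups r m"
    using Suc.IH[OF L(2) d1 t' us'] by blast
  let ?J = "J1 \<union> JG"
  have JGs: "JG \<subseteq> snd ` set G" by (auto simp: JG_def)
  have c1: "snd l \<in> ?J \<longleftrightarrow> snd l \<in> J1" if "l \<in> set L1" for l using that JGs disj by blast
  have cG: "snd l \<in> ?J \<longleftrightarrow> snd l \<in> JG" if "l \<in> set G" for l using that J1(1) disj by blast
  have e1: "dword ?J L1 = dword J1 L1" "\<And>u. distinguished u ?J L1 = distinguished u J1 L1"
    and eG: "dword ?J G = dword JG G" "\<And>u. distinguished u ?J G = distinguished u JG G"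
    by (rule dword_cong distinguished_cong, erule c1 cG)+
  have "distinguished us ?J L" using e1 eG G J1(2) L(1) by (simp add: distinguished_append)
  moreover have "dword ?J L = groups (r(m := q)) (Suc m)"
  proof -
    have "groups (r(m := q)) m = groups r m" by (rule groups_cong) auto
    then show ?thesis using e1 eG G J1(4) L(1) by (simp only: groups_Suc dword_simps fun_upd_same)
  qed
  moreover have "winv (dword ?J L) = t"
  proof -
    have "winv (dword ?J L) = winv ?y \<circ> ?t" using e1 eG G J1(3) L(1) by (simp only: dword_simps winv_append)
    then show ?thesis by (simp add: fun_eq_iff)
  qed
  moreover have "?J \<subseteq> snd ` set L" using J1(1) JGs L(1) by auto
  ultimately show ?case by blast
qed

lemma pds_w0word:
  assumes w: "w permutes {..<n}"
  defines "ws \<equiv> nths (w0word n) (pds n (w0word n) w)"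
  shows "\<exists>q. wcomm ws (groups q (n - 1))" "wprod ws = w" "set ws \<subseteq> {..<n-1}" "distinguished [] UNIV (tagged ws)"
proof -
  let ?L = "tagged (w0word n)"
  have fs: "fst ` set ?L \<subseteq> {..<n-1}" using set_w0word[of n] by (auto dest: set_zip_leftD)
  have "wcomm (map fst ?L) (groups (\<lambda>_. 0) (n - 1))" using comm_w0word_groups by simp
  then obtain L where L: "comm fst ?L L" "map fst L = groups (\<lambda>_. 0) (n - 1)"
    using comm_lift by blast
  have ms: "mset ?L = mset L" by (rule comm_mset[OF L(1)])
  have "mset (map snd L) = mset (map snd ?L)" unfolding mset_map ms ..
  then have d: "distinct (map snd L)" using mset_eq_imp_distinct_iff by fastforce
  have "{..<n} \<subseteq> {..<Suc (n - 1)}" by auto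
  then have "inv_into UNIV w permutes {..<Suc (n - 1)}" using permutes_subset[OF permutes_inv[OF w]] by blast
  from greedy_groups[OF L(2) d this, of "[]"]
  obtain J q where J: "J \<subseteq> snd ` set L" "distinguished [] J L" "winv (dword J L) = inv_into UNIV w" "dword J L = groups q (n - 1)"
    by auto
  have eq: "winv (dword J ?L) = inv_into UNIV w" using comm_winv[OF comm_dword[OF L(1)]] J(3) by metis
  then have w': "wprod (dword J ?L) = w" using wprod_eqI[of w] permutes_bij[OF w] by simp
  have PDJ: "distinguished [] J ?L" using distinguished_comm[OF L(1)] J(2) by simp
  have "set L = set ?L" using ms by (metis set_mset_mset)
  moreover have "snd ` set ?L \<subseteq> {..<length (w0word n)}" by (auto dest: set_zip_rightD)
  ultimately have "J \<subseteq> {..<length (w0word n)}" using J(1) by simp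
  then have "is_pds n (w0word n) w J" using is_pds_iff[OF set_w0word] w' PDJ by blast
  then have ws: "ws = dword J ?L" using pds_eqI[OF set_w0word] unfolding ws_def by (simp add: nths_eq_dword)
  show "\<exists>q. wcomm ws (groups q (n - 1))" using comm_dword[OF L(1), of J] J(4) ws by auto
  show "wprod ws = w" using ws w' by simp
  show sws: "set ws \<subseteq> {..<n-1}" using ws set_dword[of J ?L] fs by blast
  show "distinguished [] UNIV (tagged ws)"
  proof (rule distinguished_UNIV_reduced)
    show "fst ` set (tagged ws) \<subseteq> {..<n-1}" using sws by (auto dest: set_zip_leftD)
    show "inversions n (winv (map fst (tagged ws))) = length (tagged ws)"
      using distinguished_length[OF PDJ fs] ws by simp
  qed
qed

section \<open>Rows of the factorization\<close>

text \<open>Right multiplication by one factor, acting on a single row. Rows are functions on all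
  naturals, so that no matrix size enters.\<close>

definition act :: "nat set \<Rightarrow> (nat \<Rightarrow> real) \<Rightarrow> nat \<times> nat \<Rightarrow> (nat \<Rightarrow> real) \<Rightarrow> nat \<Rightarrow> real" where
  "act J a l x c =
     (if snd l \<in> J then (if c = fst l then - x (Suc (fst l)) else if c = Suc (fst l) then x (fst l) else x c)
      else if c = Suc (fst l) then x c + a (snd l) * x (fst l) else x c)"

definition rowv :: "nat set \<Rightarrow> (nat \<Rightarrow> real) \<Rightarrow> (nat \<times> nat) list \<Rightarrow> (nat \<Rightarrow> real) \<Rightarrow> nat \<Rightarrow> real" where
  "rowv J a L x = foldl (\<lambda>x l. act J a l x) x L"

definition unit_row :: "nat \<Rightarrow> nat \<Rightarrow> real" where
  "unit_row r c = of_bool (c = r)"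

definition pmat :: "nat set \<Rightarrow> (nat \<Rightarrow> real) \<Rightarrow> (nat \<times> nat) list \<Rightarrow> nat \<Rightarrow> nat \<Rightarrow> real" where
  "pmat J a L r = rowv J a L (unit_row r)"

lemma rowv_Nil: "rowv J a [] x = x"
  and rowv_Cons: "rowv J a (l # L) x = rowv J a L (act J a l x)"
  and rowv_snoc: "rowv J a (L @ [l]) x = act J a l (rowv J a L x)"
  and rowv_append: "rowv J a (L @ L') x = rowv J a L' (rowv J a L x)"
  by (simp_all add: rowv_def)

lemma pmat_Nil: "pmat J a [] r c = of_bool (c = r)"
  and pmat_snoc: "pmat J a (L @ [l]) r = act J a l (pmat J a L r)"
  by (simp_all add: pmat_def rowv_Nil rowv_snoc unit_row_def)

lemma rowv_linear:
  "rowv J a L (\<lambda>c. \<alpha> * x c + \<beta> * y c) c = \<alpha> * rowv J a L x c + \<beta> * rowv J a L y c"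
proof (induction L arbitrary: c rule: rev_induct)
  case (snoc l L)
  show ?case unfolding rowv_snoc act_def snoc by (simp add: algebra_simps)
qed (simp add: rowv_Nil)

lemma pmat_Cons:
  "pmat J a (l # L) r c =
     (if snd l \<in> J then (if r = fst l then pmat J a L (Suc r) c else if r = Suc (fst l) then - pmat J a L (fst l) c else pmat J a L r c)
      else pmat J a L r c + of_bool (r = fst l) * a (snd l) * pmat J a L (Suc r) c)"
proof -
  have "act J a l (unit_row r) = (\<lambda>c.
     (if snd l \<in> J then (if r = fst l then 0 else if r = Suc (fst l) then 0 else 1) else 1) * unit_row r c +
     (if snd l \<in> J then (if r = fst l then 1 else if r = Suc (fst l) then -1 else 0) else of_bool (r = fst l) * a (snd l))
       * unit_row (if r = fst l then Suc r else fst l) c)"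
    by (rule ext) (auto simp: act_def unit_row_def)
  then show ?thesis
    unfolding pmat_def rowv_Cons by (simp only: rowv_linear) auto
qed

lemma rowv_expand:
  assumes "\<And>s. k \<le> s \<Longrightarrow> x s = 0"
  shows "rowv J a L x c = (\<Sum>s<k. x s * pmat J a L s c)"
proof (induction L arbitrary: c rule: rev_induct)
  case Nil
  show ?case using assms[of c] by (cases "c < k") (simp_all add: rowv_Nil pmat_Nil of_bool_def if_distrib cong: if_cong)
next
  case (snoc l L)
  show ?case unfolding rowv_snoc pmat_snoc act_def snoc
    by (simp add: sum_distrib_left sum.distrib sum_negf algebra_simps)
qed

lemma pmat_append:
  assumes "\<And>s. k \<le> s \<Longrightarrow> pmat J a L r s = 0"
  shows "pmat J a (L @ L') r c = (\<Sum>s<k. pmat J a L r s * pmat J a L' s c)"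
  using rowv_expand[of k "pmat J a L r", OF assms] by (simp add: pmat_def rowv_append)

lemma pmat_zero:
  assumes "\<And>l. l \<in> set L \<Longrightarrow> Suc (fst l) < k" "r < k" "k \<le> c"
  shows "pmat J a L r c = 0"
  using assms(1)
proof (induction L rule: rev_induct)
  case (snoc l L)
  then have "pmat J a L r c = 0" "Suc (fst l) < k" by auto
  then show ?case using assms(3) by (auto simp: pmat_snoc act_def)
qed (use assms in \<open>simp add: pmat_Nil\<close>)

lemma scalar_row_sum:
  assumes "A \<in> carrier_mat n n" "B \<in> carrier_mat n n" "r < n" "c < n"
  shows "(A * B) $$ (r, c) = (\<Sum>s<n. A $$ (r, s) * B $$ (s, c))"
  using assms by (simp add: scalar_prod_def lessThan_atLeast0)

definition mprod :: "nat \<Rightarrow> nat set \<Rightarrow> (nat \<Rightarrow> real) \<Rightarrow> (nat \<times> nat) list \<Rightarrow> real mat" where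
  "mprod n J a L = foldr (\<lambda>l M. (if snd l \<in> J then sdot n (fst l) else xmat n (fst l) (a (snd l))) * M) L (1\<^sub>m n)"

lemma mprod_carrier: "mprod n J a L \<in> carrier_mat n n"
  by (induction L) (auto simp: mprod_def sdot_def xmat_def)

lemma mprod_index:
  assumes "\<And>l. l \<in> set L \<Longrightarrow> Suc (fst l) < n" "r < n" "c < n"
  shows "mprod n J a L $$ (r, c) = pmat J a L r c"
  using assms
proof (induction L arbitrary: r)
  case Nil
  then show ?case by (simp add: mprod_def pmat_Nil)
next
  case (Cons l L)
  let ?A = "if snd l \<in> J then sdot n (fst l) else xmat n (fst l) (a (snd l))"
  have A: "?A \<in> carrier_mat n n" by (simp add: sdot_def xmat_def)
  have l: "Suc (fst l) < n" using Cons.prems by simp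
  have "mprod n J a (l # L) $$ (r, c) = (?A * mprod n J a L) $$ (r, c)" by (simp add: mprod_def)
  also have "\<dots> = (\<Sum>s<n. ?A $$ (r, s) * mprod n J a L $$ (s, c))"
    by (rule scalar_row_sum[OF A mprod_carrier Cons.prems(2,3)])
  also have "\<dots> = (\<Sum>s<n. ?A $$ (r, s) * pmat J a L s c)"
    by (rule sum.cong) (use Cons in auto)
  also have "\<dots> = (\<Sum>s<n. (if s = r then (if snd l \<in> J \<and> (r = fst l \<or> r = Suc (fst l)) then 0 else pmat J a L s c) else 0)
       + (if s = Suc r \<and> r = fst l then (if snd l \<in> J then 1 else a (snd l)) * pmat J a L s c else 0)
       + (if s = fst l \<and> r = Suc (fst l) then (if snd l \<in> J then -1 else 0) * pmat J a L s c else 0))"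
    by (rule sum.cong[OF refl]) (use Cons.prems(2) in \<open>auto simp: sdot_def xmat_def\<close>)
  also have "\<dots> = pmat J a (l # L) r c"
    using Cons.prems(2) l
    by (cases "r = fst l"; cases "r = Suc (fst l)") (auto simp: pmat_Cons sum.distrib)
  finally show ?case .
qed

lemma Mvw_eq_mprod: "Mvw n ws J a = mprod n J a (tagged ws)"
proof -
  have "tagged ws = map (\<lambda>p. (ws ! p, p)) [0..<length ws]" by (rule nth_equalityI) auto
  then show ?thesis by (simp add: Mvw_def mprod_def foldr_map comp_def cong: if_cong)
qed

text \<open>Conjugating the elementary matrix of a negative simple root through the word keeps it strictly lower triangular:
  its support stays inside the inversions of the remaining dotted word.\<close>
lemma conjugate_lower_triangular:
  assumes "distinguished [i] J L" "\<And>l. l \<in> set L \<Longrightarrow> Suc (fst l) < n" "Suc i < n"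
  shows "\<exists>N. (\<forall>r c. N r c \<noteq> 0 \<longrightarrow> c < r \<and> winv (dword J L @ [i]) r < winv (dword J L @ [i]) c) \<and>
     (\<forall>r<n. \<forall>x. (if x = i then pmat J a L r (Suc i) else 0) = (\<Sum>c<n. N r c * pmat J a L c x))"
  using assms(1,2)
proof (induction L)
  case Nil
  \<comment> \<open>The relation reads \<open>N F = F E\<close>, where \<open>F\<close> is the
    matrix of the word and \<open>E\<close> has its only nonzero entry 1 at
    \<open>(Suc i, i)\<close>. For the empty word \<open>N\<close> is \<open>E\<close>.\<close>
  let ?N = "\<lambda>r c. if r = Suc i \<and> c = i then 1 else (0::real)"
  have "(if x = i then pmat J a [] r (Suc i) else 0) = (\<Sum>c<n. ?N r c * pmat J a [] c x)" for r x
  proof -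
    have "(\<Sum>c<n. ?N r c * pmat J a [] c x) = (\<Sum>c<n. if c = i then of_bool (r = Suc i \<and> x = i) else 0)"
      by (rule sum.cong) (auto simp: pmat_Nil)
    then show ?thesis using assms(3) by (simp add: pmat_Nil)
  qed
  then show ?case by (intro exI[of _ ?N]) auto
next
  case (Cons l L)
  let ?j = "fst l"
  let ?v = "winv (dword J L @ [i])" and ?v' = "winv (dword J (l # L) @ [i])"
  obtain N where N: "\<And>r c. N r c \<noteq> 0 \<Longrightarrow> c < r \<and> ?v r < ?v c"
    "\<And>r x. r < n \<Longrightarrow> (if x = i then pmat J a L r (Suc i) else 0) = (\<Sum>c<n. N r c * pmat J a L c x)"
  proof -
    assume *: "\<And>N. (\<And>r c. N r c \<noteq> 0 \<Longrightarrow> c < r \<and> ?v r < ?v c) \<Longrightarrow>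
      (\<And>r x. r < n \<Longrightarrow> (if x = i then pmat J a L r (Suc i) else 0) = (\<Sum>c<n. N r c * pmat J a L c x)) \<Longrightarrow> thesis"
    have "distinguished [i] J L" "\<And>l. l \<in> set L \<Longrightarrow> Suc (fst l) < n" using Cons.prems by auto
    from Cons.IH[OF this] show thesis using * by blast
  qed
  have asc: "?v ?j < ?v (Suc ?j)" and jn: "Suc ?j < n" using Cons.prems by auto
  \<comment> \<open>The only entry that the next conjugation could carry out of the strictly lower
    triangle; it vanishes because the letter is an ascent.\<close>
  have N0: "N (Suc ?j) ?j = 0" using N(1)[of "Suc ?j" ?j] asc by linarith
  show ?case
  proof (cases "snd l \<in> J")
    case True
    define \<epsilon> where "\<epsilon> r = (if r = Suc ?j then -1 else 1 :: real)" for r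
    have row: "pmat J a (l # L) r x = \<epsilon> r * pmat J a L (stp ?j r) x" for r x
      using True by (auto simp: pmat_Cons \<epsilon>_def stp_def)
    let ?N = "\<lambda>r c. \<epsilon> r * \<epsilon> c * N (stp ?j r) (stp ?j c)"
    have 1: "c < r \<and> ?v' r < ?v' c" if "?N r c \<noteq> 0" for r c
    proof -
      have *: "stp ?j c < stp ?j r" "?v (stp ?j r) < ?v (stp ?j c)" using N(1)[of "stp ?j r" "stp ?j c"] that by auto
      have "\<not> (stp ?j c = ?j \<and> stp ?j r = Suc ?j)" using * asc by auto
      then have "c < r" using stp_lessI[OF *(1), of ?j] by simp
      then show ?thesis using * True by simp
    qed
    have 2: "(if x = i then pmat J a (l # L) r (Suc i) else 0) = (\<Sum>c<n. ?N r c * pmat J a (l # L) c x)" if "r < n" for r x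
    proof -
      have "stp ?j r < n" using that jn by (auto simp: stp_def)
      then have "(if x = i then pmat J a (l # L) r (Suc i) else 0) = \<epsilon> r * (\<Sum>c<n. N (stp ?j r) c * pmat J a L c x)"
        using N(2)[of "stp ?j r" x] by (auto simp: row)
      also have "(\<Sum>c<n. N (stp ?j r) c * pmat J a L c x) = (\<Sum>c<n. N (stp ?j r) (stp ?j c) * pmat J a L (stp ?j c) x)"
        by (rule sum.reindex_bij_witness[of _ "stp ?j" "stp ?j"]) (use jn in \<open>auto simp: stp_def\<close>)
      also have "\<epsilon> r * \<dots> = (\<Sum>c<n. ?N r c * pmat J a (l # L) c x)"
        unfolding sum_distrib_left by (rule sum.cong) (auto simp: row \<epsilon>_def)
      finally show ?thesis .
    qed
    show ?thesis using 1 2 by (intro exI[of _ ?N]) blast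
  next
    case False
    let ?b = "a (snd l)"
    have row: "pmat J a (l # L) r x = pmat J a L r x + of_bool (r = ?j) * ?b * pmat J a L (Suc ?j) x" for r x
      using False by (auto simp: pmat_Cons)
    \<comment> \<open>This is \<open>(1 + b X) N (1 - b X)\<close> with \<open>X\<close> the matrix
      unit at \<open>(j, Suc j)\<close>; the quadratic term contains the factor
      \<open>N (Suc j) j\<close>, which is zero.\<close>
    let ?N = "\<lambda>r c. N r c + of_bool (r = ?j) * ?b * N (Suc ?j) c - of_bool (c = Suc ?j) * ?b * N r ?j"
    have 1: "c < r \<and> ?v' r < ?v' c" if "?N r c \<noteq> 0" for r c
    proof -
      have v': "?v' = ?v" using False by simp
      have "N r c \<noteq> 0 \<or> r = ?j \<and> N (Suc ?j) c \<noteq> 0 \<or> c = Suc ?j \<and> N r ?j \<noteq> 0"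
        using that by (auto simp: of_bool_def split: if_splits)
      then consider "N r c \<noteq> 0" | "r = ?j" "N (Suc ?j) c \<noteq> 0" | "c = Suc ?j" "N r ?j \<noteq> 0" by blast
      then show ?thesis
      proof cases
        case 1 then show ?thesis using N(1) v' by auto
      next
        case 2
        then have "c < Suc ?j" "?v (Suc ?j) < ?v c" "c \<noteq> ?j" using N(1)[of "Suc ?j" c] N0 by auto
        then show ?thesis using 2 asc v' by simp
      next
        case 3
        then have "?j < r" "?v r < ?v ?j" "r \<noteq> Suc ?j" using N(1)[of r ?j] N0 by auto
        then show ?thesis using 3 asc v' by simp
      qed
    qed
    have 2: "(if x = i then pmat J a (l # L) r (Suc i) else 0) = (\<Sum>c<n. ?N r c * pmat J a (l # L) c x)" if r: "r < n" for r x
    proof -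
      have S: "(\<Sum>c<n. M c * pmat J a (l # L) c x) = (\<Sum>c<n. M c * pmat J a L c x) + M ?j * ?b * pmat J a L (Suc ?j) x" for M
      proof -
        have "(\<Sum>c<n. M c * pmat J a (l # L) c x)
          = (\<Sum>c<n. M c * pmat J a L c x + (if c = ?j then M c * ?b * pmat J a L (Suc ?j) x else 0))"
          by (rule sum.cong) (auto simp: row algebra_simps)
        then show ?thesis using jn by (simp add: sum.distrib)
      qed
      have "(\<Sum>c<n. ?N r c * pmat J a (l # L) c x)
        = (\<Sum>c<n. N r c * pmat J a (l # L) c x) + of_bool (r = ?j) * ?b * (\<Sum>c<n. N (Suc ?j) c * pmat J a (l # L) c x)
          - (\<Sum>c<n. if c = Suc ?j then ?b * N r ?j * pmat J a (l # L) c x else 0)"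
        unfolding sum_distrib_left sum.distrib[symmetric] sum_subtractf[symmetric]
        by (rule sum.cong) (auto simp: algebra_simps)
      also have "\<dots> = (if x = i then pmat J a L r (Suc i) else 0) + of_bool (r = ?j) * ?b * (if x = i then pmat J a L (Suc ?j) (Suc i) else 0)"
        unfolding S N(2)[OF r, symmetric] N(2)[OF jn, symmetric] using jn N0 by (simp add: row)
      finally show ?thesis by (simp add: row)
    qed
    show ?thesis using 1 2 by (intro exI[of _ ?N]) blast
  qed
qed

text \<open>In \<open>N F = F E\<close>, a row of \<open>F E\<close> is the unit row at
  \<open>i\<close> times the entry in column \<open>Suc i\<close>. As \<open>N\<close> is strictly
  lower triangular, \<open>N F\<close> expresses this multiple by earlier rows, hence by rows below
  \<open>k\<close>.\<close>

lemma column_dichotomy: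
  assumes "distinguished [i] J L"
  shows "(\<forall>r<k. pmat J a L r (Suc i) = 0) \<or>
    (\<exists>\<alpha>. \<forall>x. (\<Sum>c<k. \<alpha> c * pmat J a L c x) = of_bool (x = i))"
proof (cases "\<forall>r<k. pmat J a L r (Suc i) = 0")
  case False
  define r0 where "r0 = (LEAST r. pmat J a L r (Suc i) \<noteq> 0)"
  have ex: "\<exists>r<k. pmat J a L r (Suc i) \<noteq> 0" using False by auto
  then have r0: "pmat J a L r0 (Suc i) \<noteq> 0" unfolding r0_def by (metis (mono_tags, lifting) LeastI)
  from ex obtain r where "r < k" "pmat J a L r (Suc i) \<noteq> 0" by auto
  then have r0k: "r0 < k" unfolding r0_def by (metis (mono_tags, lifting) Least_le order_le_less_trans)
  \<comment> \<open>The rows have no size, so any bound exceeding all letters, \<open>Suc i\<close>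
    and \<open>k\<close> will do.\<close>
  define n where "n = i + k + (\<Sum>l\<in>set L. fst l) + 2"
  have n: "\<And>l. l \<in> set L \<Longrightarrow> Suc (fst l) < n" "Suc i < n" "k \<le> n"
    using member_le_sum[of _ "set L" fst] unfolding n_def by force+
  obtain N where N: "\<And>r c. N r c \<noteq> 0 \<Longrightarrow> c < r"
    "\<And>r x. r < n \<Longrightarrow> (if x = i then pmat J a L r (Suc i) else 0) = (\<Sum>c<n. N r c * pmat J a L c x)"
    using conjugate_lower_triangular[OF assms n(1,2), of a] by blast
  have "(\<Sum>c<k. N r0 c / pmat J a L r0 (Suc i) * pmat J a L c x) = of_bool (x = i)" for x
  proof -
    have "(\<Sum>c<n. N r0 c * pmat J a L c x) = (\<Sum>c<k. N r0 c * pmat J a L c x)"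
    proof (rule sum.mono_neutral_right)
      have "N r0 c = 0" if "k \<le> c" for c using N(1)[of r0 c] r0k that by linarith
      then show "\<forall>c\<in>{..<n} - {..<k}. N r0 c * pmat J a L c x = 0" by auto
    qed (use n(3) in auto)
    then have "(\<Sum>c<k. N r0 c * pmat J a L c x) = (if x = i then pmat J a L r0 (Suc i) else 0)"
      using N(2)[of r0 x] r0k n(3) by simp
    then have "(\<Sum>c<k. N r0 c * pmat J a L c x) / pmat J a L r0 (Suc i) = of_bool (x = i)" using r0 by simp
    then show ?thesis by (simp add: sum_divide_distrib)
  qed
  then show ?thesis by (intro disjI2 exI allI)
qed auto

section \<open>Minors\<close>

text \<open>Columns are listed by a function, so that lists with a repetition, which arise when one
  column is replaced, are covered as well.\<close>

definition coldet :: "nat \<Rightarrow> (nat \<Rightarrow> nat \<Rightarrow> real) \<Rightarrow> (nat \<Rightarrow> nat) \<Rightarrow> real" where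
  "coldet k g h = det (mat k k (\<lambda>(s,t). g s (h t)))"

abbreviation minor :: "nat \<Rightarrow> (nat \<Rightarrow> nat \<Rightarrow> real) \<Rightarrow> nat set \<Rightarrow> real" where
  "minor k g I \<equiv> coldet k g (pick I)"

lemma coldet_cong: "(\<And>s t. s < k \<Longrightarrow> t < k \<Longrightarrow> g s (h t) = g' s (h' t)) \<Longrightarrow> coldet k g h = coldet k g' h'"
  unfolding coldet_def by (rule arg_cong[where f = det], rule eq_matI) auto

lemma coldet_column:
  assumes "t0 < k" "\<And>s. s < k \<Longrightarrow> g' s (h t0) = \<alpha> * g s u + \<beta> * g s v"
    "\<And>s t. s < k \<Longrightarrow> t < k \<Longrightarrow> t \<noteq> t0 \<Longrightarrow> g' s (h t) = g s (h t)"
  shows "coldet k g' h = \<alpha> * coldet k g (h(t0 := u)) + \<beta> * coldet k g (h(t0 := v))"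
proof -
  let ?A = "mat k k (\<lambda>(s,t). g' s (h t))"
  let ?B = "\<lambda>u. mat k k (\<lambda>(s,t). g s ((h(t0 := u)) t))"
  have cof: "cofactor ?A s t0 = cofactor (?B u) s t0" if "s < k" for s u
  proof -
    have "mat_delete ?A s t0 = mat_delete (?B u) s t0"
      by (rule eq_matI) (use assms(1,3) that in \<open>auto simp: mat_delete_def\<close>)
    then show ?thesis by (simp add: cofactor_def)
  qed
  have exp: "det M = (\<Sum>s<k. M $$ (s, t0) * cofactor M s t0)" if "M \<in> carrier_mat k k" for M :: "real mat"
    by (rule laplace_expansion_column[OF that assms(1)])
  have B: "coldet k g (h(t0 := u)) = (\<Sum>s<k. g s u * cofactor ?A s t0)" for u
    unfolding coldet_def by (subst exp) (use assms(1) cof in \<open>auto intro!: sum.cong\<close>)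
  have "coldet k g' h = (\<Sum>s<k. (\<alpha> * g s u + \<beta> * g s v) * cofactor ?A s t0)"
    unfolding coldet_def by (subst exp) (use assms(1,2) in \<open>auto intro!: sum.cong\<close>)
  then show ?thesis unfolding B by (simp add: sum_distrib_left sum.distrib algebra_simps)
qed

lemma coldet_repeated:
  assumes "t < k" "t' < k" "t \<noteq> t'" "h t = h t'"
  shows "coldet k g h = 0"
  unfolding coldet_def
  by (rule det_identical_columns[of _ k t t']) (use assms in \<open>auto intro!: eq_vecI\<close>)

lemma coldet_add_column:
  assumes "inj_on h {..<k}" "t0 < k" "t1 < k" "h t0 = j" "h t1 = i" "i \<noteq> j"
    "\<And>s c. g' s c = (if c = j then g s j + b * g s i else g s c)"
  shows "coldet k g' h = coldet k g h"
proof -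
  have "coldet k g' h = 1 * coldet k g (h(t0 := j)) + b * coldet k g (h(t0 := i))"
    by (rule coldet_column[OF assms(2)]) (use assms in \<open>auto simp: inj_on_def\<close>)
  moreover have "coldet k g (h(t0 := i)) = 0"
    by (rule coldet_repeated[of t0 _ t1]) (use assms in auto)
  moreover have "h(t0 := j) = h" using assms by auto
  ultimately show ?thesis by simp
qed

lemma pick_props:
  assumes "finite I" "card I = k"
  shows "inj_on (pick I) {..<k}" "pick I ` {..<k} = I" "s < t \<Longrightarrow> t < k \<Longrightarrow> pick I s < pick I t"
proof -
  show mono: "pick I s < pick I t" if "s < t" "t < k" for s t
    using pick_mono[of t I s] that assms by auto
  show inj: "inj_on (pick I) {..<k}"
    by (rule linorder_inj_onI) (use mono in \<open>force+\<close>)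
  show "pick I ` {..<k} = I"
    by (rule card_subset_eq[OF assms(1)]) (use pick_in_set[of _ I] assms inj in \<open>auto simp: card_image\<close>)
qed

lemma pick_mem: "finite I \<Longrightarrow> card I = k \<Longrightarrow> t < k \<Longrightarrow> pick I t \<in> I"
  using pick_in_set[of t I] by simp

lemma pick_obtain: "finite I \<Longrightarrow> card I = k \<Longrightarrow> c \<in> I \<Longrightarrow> \<exists>t<k. pick I t = c"
  using pick_props(2)[of I k] by (metis imageE lessThan_iff)

lemma pick_unique:
  assumes "\<And>s t. s < t \<Longrightarrow> t < k \<Longrightarrow> h s < (h t :: nat)" "h ` {..<k} = I" "t < k"
  shows "pick I t = h t"
proof -
  have less: "s < k \<Longrightarrow> h s < h t \<longleftrightarrow> s < t" for s using assms(1)[of s t] assms(1)[of t s] assms(3)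
    by (metis less_asym' linorder_neqE_nat)
  have "{a \<in> I. a < h t} = h ` {..<t}" using less assms(2,3) by fastforce
  moreover have "inj_on h {..<t}" by (rule linorder_inj_onI) (use assms(1,3) in \<open>force+\<close>)
  ultimately have "card {a \<in> I. a < h t} = t" by (simp add: card_image)
  moreover have "h t \<in> I" using assms(2,3) by auto
  ultimately show ?thesis using pick_card_in_set[of "h t" I] by simp
qed

text \<open>Replacing a column by a neighbour outside \<open>I\<close> keeps the list increasing, so
  no sign appears.\<close>

lemma minor_exchange:
  assumes "finite I" "card I = k" "t0 < k" "pick I t0 = c" "d \<notin> I" "d = Suc c \<or> c = Suc d"
  shows "coldet k g ((pick I)(t0 := d)) = minor k g (insert d (I - {c}))"
proof (rule coldet_cong)
  fix s t assume "t < k"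
  note p = pick_props[OF assms(1,2)]
  let ?h = "(pick I)(t0 := d)"
  have ne: "pick I t \<noteq> d" if "t < k" for t using p(2) that assms(5) by auto
  have "pick (insert d (I - {c})) t = ?h t"
  proof (rule pick_unique[OF _ _ \<open>t < k\<close>])
    fix s t assume "s < t" "t < k"
    then show "?h s < ?h t" using p(3)[of s t] assms(4,6) ne[of s] ne[of t] by auto
  next
    have "?h ` {..<k} = insert d (pick I ` ({..<k} - {t0}))" using assms(3) by auto
    also have "pick I ` ({..<k} - {t0}) = I - {c}" using p(1,2) assms(3,4) by (subst inj_on_image_set_diff[OF p(1)]) auto
    finally show "?h ` {..<k} = insert d (I - {c})" .
  qed
  then show "g s (?h t) = g s (pick (insert d (I - {c})) t)" by simp
qed

lemma minor_undotted:
  assumes "finite I" "card I = k" "snd l \<notin> J"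
  shows "minor k (\<lambda>s. act J a l (g s)) I =
    minor k g I + (if Suc (fst l) \<in> I \<and> fst l \<notin> I then a (snd l) * minor k g (insert (fst l) (I - {Suc (fst l)})) else 0)"
proof -
  note p = pick_props[OF assms(1,2)]
  let ?i = "fst l" let ?g' = "\<lambda>s. act J a l (g s)"
  show ?thesis
  proof (cases "Suc ?i \<in> I")
    case False
    have "minor k ?g' I = minor k g I"
    proof (rule coldet_cong)
      fix s t assume "t < k"
      then have "pick I t \<noteq> Suc ?i" using pick_mem[OF assms(1,2)] False by metis
      then show "?g' s (pick I t) = g s (pick I t)" using assms(3) by (simp add: act_def)
    qed
    then show ?thesis using False by simp
  next
    case True
    then obtain t0 where t0: "t0 < k" "pick I t0 = Suc ?i" using pick_obtain[OF assms(1,2)] by blast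
    show ?thesis
    proof (cases "?i \<in> I")
      case True
      then obtain t1 where t1: "t1 < k" "pick I t1 = ?i" using pick_obtain[OF assms(1,2)] by blast
      have "minor k ?g' I = minor k g I"
        by (rule coldet_add_column[OF p(1) t0(1) t1(1) t0(2) t1(2), of _ _ "a (snd l)"]) (use assms(3) in \<open>auto simp: act_def\<close>)
      then show ?thesis using True by simp
    next
      case False
      have "minor k ?g' I = 1 * coldet k g ((pick I)(t0 := Suc ?i)) + a (snd l) * coldet k g ((pick I)(t0 := ?i))"
        by (rule coldet_column[OF t0(1)]) (use assms(3) t0 p(1) in \<open>auto simp: act_def inj_on_def\<close>)
      moreover have "(pick I)(t0 := Suc ?i) = pick I" using t0 by auto
      ultimately show ?thesis
        using minor_exchange[OF assms(1,2) t0 False] False \<open>Suc ?i \<in> I\<close> by simp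
    qed
  qed
qed

text \<open>The only minus sign stands before a minor that contains \<open>Suc (fst l)\<close> but
  not \<open>fst l\<close>; in a distinguished list exactly such minors vanish.\<close>

lemma minor_dotted:
  assumes "finite I" "card I = k" "snd l \<in> J"
  shows "minor k (\<lambda>s. act J a l (g s)) I =
    (if fst l \<notin> I then minor k g (if Suc (fst l) \<in> I then insert (fst l) (I - {Suc (fst l)}) else I)
     else if Suc (fst l) \<in> I then minor k g I
     else - minor k g (insert (Suc (fst l)) (I - {fst l})))"
proof -
  note p = pick_props[OF assms(1,2)]
  let ?i = "fst l" let ?g' = "\<lambda>s. act J a l (g s)"
  consider "?i \<notin> I" "Suc ?i \<notin> I" | "?i \<notin> I" "Suc ?i \<in> I" | "?i \<in> I" "Suc ?i \<notin> I" | "?i \<in> I" "Suc ?i \<in> I" by blast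
  then show ?thesis
  proof cases
    case 1
    have "minor k ?g' I = minor k g I"
    proof (rule coldet_cong)
      fix s t assume "t < k"
      then have "pick I t \<noteq> Suc ?i" "pick I t \<noteq> ?i" using pick_mem[OF assms(1,2)] 1 by metis+
      then show "?g' s (pick I t) = g s (pick I t)" by (simp add: act_def)
    qed
    then show ?thesis using 1 by simp
  next
    case 2
    then obtain t0 where t0: "t0 < k" "pick I t0 = Suc ?i" using pick_obtain[OF assms(1,2)] by blast
    have ne: "pick I t \<noteq> ?i" if "t < k" for t using pick_mem[OF assms(1,2) that] 2(1) by metis
    have "minor k ?g' I = 1 * coldet k g ((pick I)(t0 := ?i)) + 0 * coldet k g ((pick I)(t0 := ?i))"
      by (rule coldet_column[OF t0(1)]) (use assms(3) t0 p(1) ne 2 in \<open>auto simp: act_def inj_on_def\<close>)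
    then show ?thesis using minor_exchange[OF assms(1,2) t0 2(1)] 2 by simp
  next
    case 3
    then obtain t0 where t0: "t0 < k" "pick I t0 = ?i" using pick_obtain[OF assms(1,2)] by blast
    have ne: "pick I t \<noteq> Suc ?i" if "t < k" for t using pick_mem[OF assms(1,2) that] 3(2) by metis
    have "minor k ?g' I = (-1) * coldet k g ((pick I)(t0 := Suc ?i)) + 0 * coldet k g ((pick I)(t0 := ?i))"
      by (rule coldet_column[OF t0(1)]) (use assms(3) t0 p(1) ne 3 in \<open>auto simp: act_def inj_on_def\<close>)
    then show ?thesis using minor_exchange[OF assms(1,2) t0 3(2)] 3 by simp
  next
    case 4
    then obtain t0 t1 where t: "t0 < k" "pick I t0 = ?i" "t1 < k" "pick I t1 = Suc ?i" using pick_obtain[OF assms(1,2)] by meson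
    text \<open>The dotted letter is a product of three elementary column additions.\<close>
    let ?g1 = "\<lambda>s c. if c = Suc ?i then g s (Suc ?i) + 1 * g s ?i else g s c"
    let ?g2 = "\<lambda>s c. if c = ?i then ?g1 s ?i + (-1) * ?g1 s (Suc ?i) else ?g1 s c"
    have "minor k ?g' I = minor k ?g2 I"
      by (rule coldet_add_column[OF p(1) t(3,1,4,2), of _ _ 1]) (use assms(3) in \<open>auto simp: act_def\<close>)
    also have "\<dots> = minor k ?g1 I"
      by (rule coldet_add_column[OF p(1) t(1,3,2,4), of _ _ "-1"]) auto
    also have "\<dots> = minor k g I"
      by (rule coldet_add_column[OF p(1) t(3,1,4,2), of _ _ 1]) auto
    finally show ?thesis using 4 by simp
  qed
qed

text \<open>Either a chosen column is zero, or the combination of rows giving the unit row at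
  \<open>i\<close> vanishes on all chosen columns, which makes the rows dependent.\<close>

lemma minor_zero_dichotomy:
  assumes "(\<forall>r<k. g r (Suc i) = 0) \<or> (\<exists>\<alpha>. \<forall>x. (\<Sum>c<k. \<alpha> c * g c x) = of_bool (x = i))"
    "finite I" "card I = k" "i \<notin> I" "Suc i \<in> I"
  shows "minor k g I = 0"
  using assms(1)
proof
  assume *: "\<forall>r<k. g r (Suc i) = 0"
  obtain t0 where t0: "t0 < k" "pick I t0 = Suc i" using pick_obtain[OF assms(2,3,5)] by auto
  have "minor k g I = 0 * coldet k g ((pick I)(t0 := 0)) + 0 * coldet k g ((pick I)(t0 := 0))"
    by (rule coldet_column[OF t0(1)]) (use * t0(2) in auto)
  then show ?thesis by simp
next
  assume "\<exists>\<alpha>. \<forall>x. (\<Sum>c<k. \<alpha> c * g c x) = of_bool (x = i)"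
  then obtain \<alpha> where \<alpha>: "\<And>x. (\<Sum>c<k. \<alpha> c * g c x) = of_bool (x = i)" by blast
  let ?A = "mat k k (\<lambda>(s,t). g s (pick I t))"
  have A: "?A \<in> carrier_mat k k" by simp
  have "vec k \<alpha> \<noteq> 0\<^sub>v k"
  proof
    assume "vec k \<alpha> = 0\<^sub>v k"
    then have "\<alpha> c = 0" if "c < k" for c using that by (metis index_vec index_zero_vec(1))
    then show False using \<alpha>[of i] by simp
  qed
  moreover have "?A\<^sup>T *\<^sub>v vec k \<alpha> = 0\<^sub>v k"
  proof (rule eq_vecI)
    fix t assume "t < dim_vec (0\<^sub>v k :: real vec)"
    then have t: "t < k" by simp
    have "pick I t \<noteq> i" using pick_mem[OF assms(2,3)] t assms(4) by auto
    then show "(?A\<^sup>T *\<^sub>v vec k \<alpha>) $ t = 0\<^sub>v k $ t"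
      using t \<alpha>[of "pick I t"] by (simp add: scalar_prod_def lessThan_atLeast0 mult.commute)
  qed simp
  ultimately have "det (?A\<^sup>T) = 0"
    by (subst det_0_iff_vec_prod_zero_field[of _ k]) (auto intro!: exI[of _ "vec k \<alpha>"])
  then show ?thesis unfolding coldet_def using det_transpose[OF A] by simp
qed

lemma minor_initial: "minor k (\<lambda>s. pmat J a [] s) {..<k} = 1"
proof -
  have "pick {..<k} t = t" if "t < k" for t by (rule pick_unique[of k id, simplified]) (use that in auto)
  then have "mat k k (\<lambda>(s,t). pmat J a [] s (pick {..<k} t)) = (1\<^sub>m k :: real mat)"
    by (intro eq_matI) (auto simp: pmat_Nil)
  then show ?thesis by (simp add: coldet_def)
qed

lemma minor_initial_other:
  assumes "finite I" "card I = k" "I \<noteq> {..<k}"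
  shows "minor k (\<lambda>s. pmat J a [] s) I = 0"
proof -
  have "\<not> {..<k} \<subseteq> I" using card_subset_eq[OF assms(1), of "{..<k}"] assms by auto
  then obtain s where s: "s < k" "s \<notin> I" by auto
  let ?A = "mat k k (\<lambda>(s,t). pmat J a [] s (pick I t))"
  have A: "?A \<in> carrier_mat k k" by simp
  have "?A\<^sup>T *\<^sub>v unit_vec k s = 0\<^sub>v k"
  proof (rule eq_vecI)
    fix t assume "t < dim_vec (0\<^sub>v k :: real vec)"
    then have t: "t < k" by simp
    have "pick I t \<noteq> s" using pick_mem[OF assms(1,2)] t s by auto
    then show "(?A\<^sup>T *\<^sub>v unit_vec k s) $ t = 0\<^sub>v k $ t"
      using t s(1) by (simp add: pmat_Nil)
  qed simp
  moreover have "(unit_vec k s :: real vec) \<noteq> 0\<^sub>v k" using s(1) by (metis index_unit_vec(1) index_zero_vec(1) zero_neq_one)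
  ultimately have "det (?A\<^sup>T) = 0"
    by (subst det_0_iff_vec_prod_zero_field[of _ k]) (auto intro!: exI[of _ "unit_vec k s"])
  then show ?thesis unfolding coldet_def using det_transpose[OF A] by simp
qed

section \<open>Nonnegativity and support of the minors\<close>

lemma exchange_set_props:
  assumes "finite I" "c \<in> I" "d \<notin> I"
  shows "finite (insert d (I - {c}))" "card (insert d (I - {c})) = card I"
proof -
  show "finite (insert d (I - {c}))" using assms by simp
  have "card (insert d (I - {c})) = Suc (card (I - {c}))" using assms by (intro card_insert_disjoint) auto
  then show "card (insert d (I - {c})) = card I" using card_Suc_Diff1[OF assms(1,2)] by simp
qed

text \<open>An undotted letter forms sums with positive coefficients and a dotted one only moves
  index sets, its negative term being zero. Two parameter vectors run in parallel so that the
  induction compares their supports.\<close>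

lemma minor_nonneg_support:
  assumes "distinguished [] J L" "\<And>l. l \<in> set L \<Longrightarrow> snd l \<notin> J \<Longrightarrow> 0 < a (snd l)" 
    "\<And>l. l \<in> set L \<Longrightarrow> snd l \<notin> J \<Longrightarrow> 0 < a' (snd l)" "finite I" "card I = k"
  shows "0 \<le> minor k (pmat J a L) I \<and> 0 \<le> minor k (pmat J a' L) I \<and>
    (minor k (pmat J a L) I = 0 \<longleftrightarrow> minor k (pmat J a' L) I = 0)"
  using assms
proof (induction L arbitrary: I rule: rev_induct)
  case Nil
  then show ?case using minor_initial minor_initial_other by (cases "I = {..<k}") auto
next
  case (snoc l L)
  let ?i = "fst l"
  have pre: "distinguished [] J L" using snoc.prems(1) distinguished_prefix by blast
  have eq: "pmat J b (L @ [l]) = (\<lambda>s. act J b l (pmat J b L s))" for b by (rule ext) (rule pmat_snoc)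
  have IH: "0 \<le> minor k (pmat J a L) K \<and> 0 \<le> minor k (pmat J a' L) K \<and>
    (minor k (pmat J a L) K = 0 \<longleftrightarrow> minor k (pmat J a' L) K = 0)" if "finite K" "card K = k" for K
    by (rule snoc.IH[OF pre]) (use snoc.prems that in auto)
  show ?case
  proof (cases "snd l \<in> J")
    case True
    then have "distinguished [?i] J L" using snoc.prems(1) by (simp add: distinguished_append)
    from column_dichotomy[OF this]
    have zero: "minor k (pmat J b L) K = 0" if "finite K" "card K = k" "?i \<notin> K" "Suc ?i \<in> K" for K b
      by (rule minor_zero_dichotomy[OF _ that])
    show ?thesis unfolding eq minor_dotted[OF snoc.prems(4,5) True]
      using IH[OF snoc.prems(4,5)] IH[OF exchange_set_props[of I "Suc ?i" ?i, unfolded snoc.prems(5)]]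
        zero[OF exchange_set_props[of I ?i "Suc ?i", unfolded snoc.prems(5)]] snoc.prems(4)
      by auto
  next
    case False
    then have pos: "0 < a (snd l)" "0 < a' (snd l)" using snoc.prems(2,3) by auto
    show ?thesis unfolding eq minor_undotted[OF snoc.prems(4,5) False]
      using IH[OF snoc.prems(4,5)] IH[OF exchange_set_props[of I "Suc ?i" ?i, unfolded snoc.prems(5)]] pos snoc.prems(4)
      by (auto simp: add_nonneg_eq_0_iff zero_le_mult_iff)
  qed
qed

lemma minor_leading_block:
  assumes "\<And>l. l \<in> set L \<Longrightarrow> Suc (fst l) < k"
  shows "minor k (pmat J a L) {..<k} = 1"
  using assms
proof (induction L rule: rev_induct)
  case Nil
  show ?case using minor_initial[of k J a] by simp
next
  case (snoc l L)
  have eq: "pmat J a (L @ [l]) = (\<lambda>s. act J a l (pmat J a L s))" by (rule ext) (rule pmat_snoc)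
  have "Suc (fst l) < k" "fst l < k" using snoc.prems[of l] by auto
  moreover have "minor k (pmat J a L) {..<k} = 1" using snoc by simp
  ultimately show ?case unfolding eq
    using minor_dotted[of "{..<k}" k l J a "pmat J a L"] minor_undotted[of "{..<k}" k l J a "pmat J a L"]
    by (cases "snd l \<in> J") simp_all
qed

lemma minor_append_block:
  assumes "\<And>l. l \<in> set L \<Longrightarrow> Suc (fst l) < k" 
  shows "coldet k (pmat J a (L @ L')) h = coldet k (pmat J a L') h"
proof -
  let ?C = "mat k k (\<lambda>(r,s). pmat J a L r s)" and ?F = "mat k k (\<lambda>(s,t). pmat J a L' s (h t))"
  have C: "?C \<in> carrier_mat k k" and F: "?F \<in> carrier_mat k k" by simp_all
  have z: "pmat J a L r s = 0" if "r < k" "k \<le> s" for r s using pmat_zero[where L = L and k = k and r = r and c = s] assms that by blast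
  have "mat k k (\<lambda>(s,t). pmat J a (L @ L') s (h t)) = ?C * ?F"
  proof (rule eq_matI)
    fix r t assume "r < dim_row (?C * ?F)" "t < dim_col (?C * ?F)"
    then have rt: "r < k" "t < k" by auto
    have "pmat J a (L @ L') r (h t) = (\<Sum>s<k. pmat J a L r s * pmat J a L' s (h t))"
      by (rule pmat_append) (use z rt in auto)
    then show "mat k k (\<lambda>(s,t). pmat J a (L @ L') s (h t)) $$ (r, t) = (?C * ?F) $$ (r, t)"
      using rt scalar_row_sum[OF C F rt] by simp
  qed auto
  moreover have "det ?C = 1"
  proof -
    have "pick {..<k} t = t" if "t < k" for t by (rule pick_unique[of k id, simplified]) (use that in auto)
    then have "minor k (pmat J a L) {..<k} = coldet k (pmat J a L) (\<lambda>t. t)" by (intro coldet_cong) auto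
    then show ?thesis using minor_leading_block[OF assms, where J = J and a = a] by (simp add: coldet_def)
  qed
  ultimately show ?thesis unfolding coldet_def using det_mult[OF C F] by simp
qed

section \<open>Leading and trailing entries\<close>

definition shift :: "nat \<times> nat \<Rightarrow> nat \<Rightarrow> nat" where
  "shift l z = (if z = fst l then Suc z else z)"

primrec trail :: "(nat \<times> nat) list \<Rightarrow> nat \<Rightarrow> nat" where
  "trail [] z = z"
| "trail (l # L) z = trail L (shift l z)"

text \<open>The absolute value of the trailing entry: an undotted letter multiplies it by the
  parameter while moving it, a dotted letter only moves it.\<close>

primrec weight :: "nat set \<Rightarrow> (nat \<Rightarrow> real) \<Rightarrow> (nat \<times> nat) list \<Rightarrow> nat \<Rightarrow> real" where
  "weight J a [] z = 1"
| "weight J a (l # L) z = (if z = fst l \<and> snd l \<notin> J then a (snd l) else 1) * weight J a L (shift l z)"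

text \<open>\<open>Z\<close> holds trailing positions. Letter \<open>i\<close> moves a trailing position \<open>i\<close> to \<open>Suc i\<close>; this can only
  collide with, or cancel against, a row whose trailing position is already \<open>Suc i\<close>.\<close>
primrec unobstructed :: "(nat \<times> nat) list \<Rightarrow> nat set \<Rightarrow> bool" where
  "unobstructed [] Z \<longleftrightarrow> True"
| "unobstructed (l # L) Z \<longleftrightarrow> Suc (fst l) \<notin> Z \<and> unobstructed L (shift l ` Z)"

lemma trail_append: "trail (L @ L') z = trail L' (trail L z)"
  by (induction L arbitrary: z) auto

lemma weight_append: "weight J a (L @ L') z = weight J a L z * weight J a L' (trail L z)"
  by (induction L arbitrary: z) auto

lemma unobstructed_append: "unobstructed (L @ L') Z \<longleftrightarrow> unobstructed L Z \<and> unobstructed L' (trail L ` Z)"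
  by (induction L arbitrary: Z) (auto simp: image_image)

lemma weight_pos: "(\<And>l. l \<in> set L \<Longrightarrow> snd l \<notin> J \<Longrightarrow> 0 < a (snd l)) \<Longrightarrow> 0 < weight J a L z"
  by (induction L arbitrary: z) auto

text \<open>The delicate step is a dotted letter \<open>i\<close> acting on a row with leading position \<open>i\<close>: if the
  unit row at \<open>i\<close> lies in the row span, expanding it in the rows and comparing smallest leading
  and largest trailing positions shows that this row is already a multiple of it.\<close>
lemma leading_trailing:
  assumes "distinguished [] J L" "unobstructed L {..<k}" "\<And>l. l \<in> set L \<Longrightarrow> snd l \<notin> J \<Longrightarrow> 0 < a (snd l)"
  shows "inj_on (trail L) {..<k} \<and> (\<forall>s<k.
    \<bar>pmat J a L s (winv (dword J L) s)\<bar> = 1 \<and> (\<forall>c<winv (dword J L) s. pmat J a L s c = 0) \<and>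
    \<bar>pmat J a L s (trail L s)\<bar> = weight J a L s \<and> (\<forall>c>trail L s. pmat J a L s c = 0))"
  using assms
proof (induction L rule: rev_induct)
  case Nil
  then show ?case by (auto simp: pmat_Nil)
next
  case (snoc l L)
  let ?i = "fst l" and ?f = "winv (dword J L)" and ?g = "pmat J a L"
  have pre: "distinguished [] J L" using snoc.prems(1) distinguished_prefix by blast
  have unobstructed: "unobstructed L {..<k}" "\<And>s. s < k \<Longrightarrow> trail L s \<noteq> Suc ?i"
    using snoc.prems(2) by (simp_all add: unobstructed_append) (metis image_eqI lessThan_iff)
  have IH: "inj_on (trail L) {..<k}" "\<And>s. s < k \<Longrightarrow> \<bar>?g s (?f s)\<bar> = 1"
    "\<And>s c. s < k \<Longrightarrow> c < ?f s \<Longrightarrow> ?g s c = 0" "\<And>s. s < k \<Longrightarrow> \<bar>?g s (trail L s)\<bar> = weight J a L s"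
    "\<And>s c. s < k \<Longrightarrow> trail L s < c \<Longrightarrow> ?g s c = 0"
    using snoc.IH[OF pre unobstructed(1)] snoc.prems(3) by auto
  have trail': "trail (L @ [l]) s = shift l (trail L s)" for s by (simp add: trail_append)
  have "inj_on (trail (L @ [l])) {..<k}"
  proof (rule inj_onI)
    fix x y assume xy: "x \<in> {..<k}" "y \<in> {..<k}" "trail (L @ [l]) x = trail (L @ [l]) y"
    then have "trail L x = trail L y"
      using unobstructed(2)[of x] unobstructed(2)[of y] by (simp add: trail' shift_def split: if_splits)
    then show "x = y" using IH(1) xy by (auto dest: inj_onD)
  qed
  moreover have "\<bar>pmat J a (L @ [l]) s (trail (L @ [l]) s)\<bar> = weight J a (L @ [l]) s"
    and "trail (L @ [l]) s < c \<Longrightarrow> pmat J a (L @ [l]) s c = 0" if s: "s < k" for s c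
  proof -
    have pos: "snd l \<notin> J \<Longrightarrow> 0 < a (snd l)" using snoc.prems(3) by auto
    show "\<bar>pmat J a (L @ [l]) s (trail (L @ [l]) s)\<bar> = weight J a (L @ [l]) s"
      using unobstructed(2)[OF s] IH(4,5)[OF s] pos
      by (auto simp: trail' shift_def pmat_snoc act_def weight_append abs_mult)
    show "trail (L @ [l]) s < c \<Longrightarrow> pmat J a (L @ [l]) s c = 0"
      using unobstructed(2)[OF s] IH(5)[OF s]
      by (auto simp: trail' shift_def pmat_snoc act_def split: if_splits)
  qed
  moreover have "\<bar>pmat J a (L @ [l]) s (winv (dword J (L @ [l])) s)\<bar> = 1"
    and "c < winv (dword J (L @ [l])) s \<Longrightarrow> pmat J a (L @ [l]) s c = 0" if s: "s < k" for s c
  proof -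
    \<comment> \<open>A dotted letter writes minus the entry of column \<open>Suc i\<close> into
      column \<open>i\<close>. When the leading position moves from \<open>i\<close> to
      \<open>Suc i\<close>, this entry must therefore be zero.\<close>
    have dot: "?g s (Suc ?i) = 0" if J: "snd l \<in> J" and fs: "?f s = ?i"
    proof -
      have "distinguished [?i] J L" using snoc.prems(1) J by (simp add: distinguished_append)
      from column_dichotomy[OF this, of k a] show ?thesis
      proof
        assume "\<exists>\<alpha>. \<forall>x. (\<Sum>c<k. \<alpha> c * ?g c x) = of_bool (x = ?i)"
        then obtain \<alpha> where \<alpha>: "\<And>x. (\<Sum>c<k. \<alpha> c * ?g c x) = of_bool (x = ?i)" by blast
        define U where "U = {c. c < k \<and> \<alpha> c \<noteq> 0}"
        have U: "finite U" "U \<noteq> {}"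
        proof -
          show "U \<noteq> {}"
          proof
            assume "U = {}"
            then have "(\<Sum>c<k. \<alpha> c * ?g c ?i) = 0" by (intro sum.neutral) (auto simp: U_def)
            then show False using \<alpha>[of ?i] by simp
          qed
        qed (simp add: U_def)
        obtain u where u: "u \<in> U" "\<And>c. c \<in> U \<Longrightarrow> ?f u \<le> ?f c"
        proof -
          have "Min (?f ` U) \<in> ?f ` U" using U by (intro Min_in) auto
          then obtain u where "u \<in> U" "?f u = Min (?f ` U)" by (metis imageE)
          then show thesis using that[of u] U(1) by simp
        qed
        obtain u' where u': "u' \<in> U" "\<And>c. c \<in> U \<Longrightarrow> trail L c \<le> trail L u'"
        proof -
          have "Max (trail L ` U) \<in> trail L ` U" using U by (intro Max_in) auto
          then obtain u where "u \<in> U" "trail L u = Max (trail L ` U)" by (metis imageE)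
          then show thesis using that[of u] U(1) by simp
        qed
        have "(\<Sum>c<k. \<alpha> c * ?g c (?f u)) = (\<Sum>c<k. if c = u then \<alpha> u * ?g u (?f u) else 0)"
        proof (rule sum.cong[OF refl])
          fix c assume c: "c \<in> {..<k}"
          show "\<alpha> c * ?g c (?f u) = (if c = u then \<alpha> u * ?g u (?f u) else 0)"
          proof (cases "c = u \<or> \<alpha> c = 0")
            case False
            then have "?f u < ?f c" using u(2)[of c] c by (simp add: U_def order_less_le)
            then show ?thesis using IH(3)[of c "?f u"] c False by simp
          qed auto
        qed
        also have "\<dots> \<noteq> 0" using u(1) IH(2)[of u] by (auto simp: U_def)
        finally have "?f u = ?i" using \<alpha>[of "?f u"] by (simp split: if_splits)
        then have "u = s" using fs by (metis winv_eq_iff)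
        have "(\<Sum>c<k. \<alpha> c * ?g c (trail L u')) = (\<Sum>c<k. if c = u' then \<alpha> u' * ?g u' (trail L u') else 0)"
        proof (rule sum.cong[OF refl])
          fix c assume c: "c \<in> {..<k}"
          show "\<alpha> c * ?g c (trail L u') = (if c = u' then \<alpha> u' * ?g u' (trail L u') else 0)"
          proof (cases "c = u' \<or> \<alpha> c = 0")
            case False
            then have "trail L c < trail L u'"
              using u'(2)[of c] u'(1) c inj_on_eq_iff[OF IH(1), of c u'] by (simp add: U_def order_less_le)
            then show ?thesis using IH(5)[of c "trail L u'"] c False by simp
          qed auto
        qed
        also have "\<dots> \<noteq> 0"
          using u'(1) IH(4)[of u'] weight_pos[of L J a u'] snoc.prems(3) by (force simp: U_def)
        finally have "trail L u' = ?i" using \<alpha>[of "trail L u'"] by (simp split: if_splits)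
        then have "trail L s \<le> ?i" using u'(2)[of s] u(1) \<open>u = s\<close> by simp
        then show ?thesis using IH(5)[OF s, of "Suc ?i"] by simp
      qed (use s in auto)
    qed
    show "\<bar>pmat J a (L @ [l]) s (winv (dword J (L @ [l])) s)\<bar> = 1"
      using IH(2,3)[OF s] dot
      by (cases "snd l \<in> J") (auto simp: winv_append pmat_snoc act_def stp_def)
    show "c < winv (dword J (L @ [l])) s \<Longrightarrow> pmat J a (L @ [l]) s c = 0"
      using IH(3)[OF s] dot
      by (cases "snd l \<in> J") (auto simp: winv_append pmat_snoc act_def stp_def split: if_splits)
  qed
  ultimately show ?case by blast
qed

text \<open>After a letter \<open>j\<close> has acted, column \<open>j\<close> holds no trailing
  position, so the next letter \<open>j - 1\<close> finds its target free; only the first target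
  must be free in advance.\<close>

lemma unobstructed_group:
  assumes "map fst G = rev [q..<m]" "m \<notin> Z"
  shows "unobstructed G Z"
  using assms
proof (induction m arbitrary: G Z)
  case (Suc m)
  show ?case
  proof (cases "q \<le> m")
    case True
    then obtain l G' where G: "G = l # G'" "fst l = m" "map fst G' = rev [q..<m]"
      using Suc.prems(1) by (auto simp: map_eq_Cons_conv)
    have "m \<notin> shift l ` Z" using G(2) by (auto simp: shift_def split: if_splits)
    then show ?thesis using Suc.IH[OF G(3)] Suc.prems(2) G by simp
  qed (use Suc.prems in simp)
qed simp

lemma trail_le: "(\<And>l. l \<in> set L \<Longrightarrow> fst l < m) \<Longrightarrow> z \<le> m \<Longrightarrow> trail L z \<le> m"
proof (induction L arbitrary: z)
  case (Cons l L)
  then have "shift l z \<le> m" by (fastforce simp: shift_def)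
  then show ?case using Cons by simp
qed simp

text \<open>Run \<open>m\<close> moves trailing positions no further than \<open>Suc m\<close>,
  which leaves the first target \<open>Suc (Suc m)\<close> of the next run free.\<close>

lemma unobstructed_groups:
  assumes "map fst L = concat (map (\<lambda>j. rev [q j..<Suc j]) [m..<M])" "Z \<subseteq> {..m}"
  shows "unobstructed L Z"
  using assms
proof (induction "M - m" arbitrary: m L Z)
  case 0
  then show ?case by simp
next
  case (Suc d)
  then have "[m..<M] = m # [Suc m..<M]" by (simp add: upt_conv_Cons)
  then obtain G L' where L: "L = G @ L'" "map fst G = rev [q m..<Suc m]"
      "map fst L' = concat (map (\<lambda>j. rev [q j..<Suc j]) [Suc m..<M])"
    using Suc.prems(1) by (auto simp: map_eq_append_conv simp del: upt_Suc)
  have "Suc m \<notin> Z" using Suc.prems(2) by auto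
  then have "unobstructed G Z" by (rule unobstructed_group[OF L(2)])
  moreover have "fst l < Suc m" if "l \<in> set G" for l
  proof -
    have "fst l \<in> set (map fst G)" using that by simp
    then show ?thesis unfolding L(2) set_rev set_upt by simp
  qed
  then have "trail G ` Z \<subseteq> {..Suc m}" using trail_le[of G "Suc m"] Suc.prems(2) by fastforce
  then have "unobstructed L' (trail G ` Z)" using Suc.hyps(1)[OF _ L(3)] Suc.hyps(2) by simp
  ultimately show ?case by (simp add: L(1) unobstructed_append)
qed

section \<open>Gale order and extremal indices\<close>

text \<open>Pigeonhole: otherwise the \<open>t + 1\<close> smallest elements of \<open>J\<close>
  would all be images of the \<open>t\<close> elements of \<open>I\<close> that precede its entry at
  index \<open>t\<close>.\<close>

lemma gale_leI:
  assumes "bij_betw p I J" "finite I" "\<And>x. x \<in> I \<Longrightarrow> x \<le> (p x :: nat)"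
  shows "gale_le I J"
  unfolding gale_le_def list_all2_conv_all_nth
proof (intro conjI allI impI)
  have finJ: "finite J" using assms(1,2) bij_betw_finite by blast
  have card: "card I = card J" by (rule bij_betw_same_card[OF assms(1)])
  let ?xs = "sorted_list_of_set I" and ?ys = "sorted_list_of_set J"
  show "length ?xs = length ?ys" using card by simp
  fix t assume "t < length ?xs"
  then have t: "t < card I" by simp
  show "?xs ! t \<le> ?ys ! t"
  proof (rule ccontr)
    assume "\<not> ?thesis"
    then have lt: "?ys ! t < ?xs ! t" by simp
    let ?A = "{x \<in> I. p x \<le> ?ys ! t}"
    have sI: "sorted_wrt (<) ?xs" and sJ: "sorted_wrt (<) ?ys" by simp_all
    have "(\<lambda>s. ?ys ! s) ` {..t} \<subseteq> p ` ?A"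
    proof
      fix y assume "y \<in> (\<lambda>s. ?ys ! s) ` {..t}"
      then obtain s where s: "s \<le> t" "y = ?ys ! s" by auto
      have "y \<in> J" using s t card nth_mem[of s ?ys] finJ by simp
      moreover have "y \<le> ?ys ! t"
        using s t card sorted_wrt_nth_less[OF sJ, of s t] by (cases "s = t") auto
      ultimately show "y \<in> p ` ?A" using assms(1) unfolding bij_betw_def by blast
    qed
    then have "card ((\<lambda>s. ?ys ! s) ` {..t}) \<le> card (p ` ?A)" using assms(2) by (intro card_mono) auto
    also have "\<dots> \<le> card ?A" using assms(2) by (intro card_image_le) auto
    also have "?A \<subseteq> (\<lambda>s. ?xs ! s) ` {..<t}"
    proof
      fix x assume "x \<in> ?A"
      then have x: "x \<in> I" "x < ?xs ! t" using assms(3)[of x] lt by auto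
      then obtain s where s: "s < card I" "x = ?xs ! s"
        using assms(2) by (metis in_set_conv_nth length_sorted_list_of_set set_sorted_list_of_set)
      have "s < t"
      proof (rule ccontr)
        assume "\<not> s < t"
        then show False using sorted_wrt_nth_less[OF sI, of t s] s x t by (cases "s = t") auto
      qed
      then show "x \<in> (\<lambda>s. ?xs ! s) ` {..<t}" using s by auto
    qed
    then have "card ?A \<le> card ((\<lambda>s. ?xs ! s) ` {..<t})" by (intro card_mono) auto
    also have "\<dots> \<le> t" using card_image_le[of "{..<t}" "\<lambda>s. ?xs ! s"] by simp
    finally have "card ((\<lambda>s. ?ys ! s) ` {..t}) \<le> t" .
    moreover have "inj_on (\<lambda>s. ?ys ! s) {..t}"
      using t card by (intro inj_on_nth) auto
    ultimately show False by (simp add: card_image)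
  qed
qed

lemma gale_le_antisym:
  assumes "gale_le I J" "gale_le J I" "finite I" "finite J"
  shows "I = J"
proof -
  have "sorted_list_of_set I = sorted_list_of_set J"
    using assms(1,2) unfolding gale_le_def list_all2_conv_all_nth
    by (intro nth_equalityI) (auto intro: order_antisym)
  then show ?thesis using assms(3,4) by (metis set_sorted_list_of_set)
qed

text \<open>\<open>f\<close> and \<open>z\<close> are the leading and trailing positions of \<open>k\<close> rows. Any nonzero maximal minor needs a
  matching of rows to columns within these bounds, and comparing sums of matched columns settles
  all questions about which minors vanish along the chain.\<close>
locale matching_system =
  fixes n k :: nat and P :: "nat set \<Rightarrow> real" and f z :: "nat \<Rightarrow> nat"
  assumes f_inj: "inj_on f {..<k}" and z_inj: "inj_on z {..<k}"
    and f_le_z: "s < k \<Longrightarrow> f s \<le> z s" and z_less: "s < k \<Longrightarrow> z s < n"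
begin

text \<open>Rows leading before the threshold \<open>c\<close> contribute their leading column, the
  others their trailing column. \<open>chain n\<close> is the Gale-minimal set, and lowering
  \<open>c\<close> runs along the orbit.\<close>

definition chain :: "nat \<Rightarrow> nat set" where
  "chain c = f ` {s. s < k \<and> f s < c} \<union> z ` {s. s < k \<and> c \<le> f s}"

abbreviation cut :: "nat \<Rightarrow> nat \<Rightarrow> nat" where
  "cut c s \<equiv> if f s < c then f s else z s"

lemma bij_cut: "bij_betw (cut c) {..<k} (chain c)"
proof (rule bij_betw_imageI)
  have ne: "f s \<noteq> z t" if "f s < c" "\<not> f t < c" "t < k" for s t using f_le_z[of t] that by simp
  show "inj_on (cut c) {..<k}"
  proof (rule inj_onI)
    fix s t assume st: "s \<in> {..<k}" "t \<in> {..<k}" "cut c s = cut c t"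
    then show "s = t"
      using ne[of s t] ne[of t s] f_inj z_inj by (auto split: if_splits dest: inj_onD)
  qed
  show "cut c ` {..<k} = chain c" by (force simp: chain_def)
qed

lemma finite_chain: "finite (chain c)" and chain_subset: "chain c \<subseteq> {..<n}" and card_chain: "card (chain c) = k"
proof -
  show "finite (chain c)" by (simp add: chain_def)
  show "chain c \<subseteq> {..<n}" using f_le_z z_less by (fastforce simp: chain_def)
  show "card (chain c) = k" using bij_betw_same_card[OF bij_cut[of c]] by simp
qed

lemma chain_upper: "chain c \<inter> {c..} = z ` {s. s < k \<and> c \<le> f s}"
  using f_le_z by (fastforce simp: chain_def)

definition matches :: "(nat \<Rightarrow> nat) \<Rightarrow> nat set \<Rightarrow> bool" where
  "matches p I \<longleftrightarrow> bij_betw p {..<k} I \<and> (\<forall>s<k. f s \<le> p s \<and> p s \<le> z s)"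

text \<open>The rows leading at or after \<open>c\<close> must use columns at or after
  \<open>c\<close>. If \<open>I\<close> has no more such columns than there are such rows, these
  columns are used up, and their sum is bounded by the sum of the trailing positions.\<close>

lemma matches_upper:
  assumes "matches p I" "finite I" "card (I \<inter> {c..}) \<le> card {s. s < k \<and> c \<le> f s}"
  shows "p ` {s. s < k \<and> c \<le> f s} = I \<inter> {c..}" "\<Sum> (I \<inter> {c..}) = (\<Sum>s | s < k \<and> c \<le> f s. p s)"
    "\<Sum> (I \<inter> {c..}) \<le> \<Sum> (z ` {s. s < k \<and> c \<le> f s})"
proof -
  let ?T = "{s. s < k \<and> c \<le> f s}"
  have sub: "p ` ?T \<subseteq> I \<inter> {c..}" using assms(1) by (fastforce simp: matches_def bij_betw_def)
  have inj: "inj_on p ?T" using assms(1) by (auto simp: matches_def bij_betw_def intro: inj_on_subset)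
  show eq: "p ` ?T = I \<inter> {c..}"
    by (rule card_seteq[OF _ sub]) (use assms(2,3) inj in \<open>simp_all add: card_image\<close>)
  show sum: "\<Sum> (I \<inter> {c..}) = (\<Sum>s\<in>?T. p s)" unfolding eq[symmetric] by (simp add: sum.reindex[OF inj])
  have "(\<Sum>s\<in>?T. p s) \<le> (\<Sum>s\<in>?T. z s)" using assms(1) by (intro sum_mono) (auto simp: matches_def)
  moreover have "inj_on z ?T" using z_inj by (rule inj_on_subset) auto
  ultimately show "\<Sum> (I \<inter> {c..}) \<le> \<Sum> (z ` ?T)" unfolding sum by (simp add: sum.reindex)
qed

text \<open>Equality in the sum bound forces the upper rows to their trailing columns; the remaining
  rows then have the sum of their leading columns and attain it termwise. Hence a chain minor has a
  single surviving Leibniz term.\<close>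

lemma matches_chain_unique:
  assumes "matches p (chain c)" "s < k"
  shows "p s = cut c s"
proof -
  let ?T = "{s. s < k \<and> c \<le> f s}" and ?S = "{s. s < k \<and> f s < c}"
  have zT: "inj_on z ?T" and fS: "inj_on f ?S" using z_inj f_inj by (auto intro: inj_on_subset)
  have p: "inj_on p {..<k}" "p ` {..<k} = chain c" "\<And>s. s < k \<Longrightarrow> f s \<le> p s \<and> p s \<le> z s"
    using assms(1) by (auto simp: matches_def bij_betw_def)
  have up: "p ` ?T = z ` ?T" "(\<Sum>s\<in>?T. z s) = (\<Sum>s\<in>?T. p s)"
    using matches_upper(1,2)[OF assms(1) finite_chain, of c] unfolding chain_upper
    by (simp_all add: card_image[OF zT] sum.reindex[OF zT])
  have T: "p s = z s" if "s \<in> ?T" for s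
    using sum_mono_inv[OF up(2)[symmetric] _ that] p(3) by auto
  have pk: "{..<k} = ?S \<union> ?T" "?S \<inter> ?T = {}" by auto
  have "p ` ?S = chain c - p ` ?T"
  proof -
    have "?S = {..<k} - ?T" by auto
    then have "p ` ?S = p ` {..<k} - p ` ?T"
      using inj_on_image_set_diff[OF p(1), of "{..<k}" ?T] by auto
    then show ?thesis using p(2) by simp
  qed
  also have "\<dots> = f ` ?S"
  proof -
    have "f ` ?S \<inter> z ` ?T = {}" using f_le_z by force
    then show ?thesis unfolding up chain_def by blast
  qed
  finally have "p ` ?S = f ` ?S" .
  moreover have "inj_on p ?S" using p(1) by (rule inj_on_subset) auto
  ultimately have "(\<Sum>s\<in>?S. f s) = (\<Sum>s\<in>?S. p s)" using sum.reindex[OF fS, of id] sum.reindex[of p ?S id] by simp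
  from sum_mono_inv[OF this] have "f s = p s" if "s \<in> ?S" for s using that p(3) by auto
  then show ?thesis using T assms(2) by (cases "f s < c") auto
qed

end

locale extremal_system = matching_system +
  assumes chain_nonzero: "P (chain c) \<noteq> 0"
    and nonzero_matches: "I \<subseteq> {..<n} \<Longrightarrow> card I = k \<Longrightarrow> P I \<noteq> 0 \<Longrightarrow> \<exists>p. matches p I"
begin

lemma gale_le_chain:
  assumes "I \<subseteq> {..<n}" "card I = k" "P I \<noteq> 0"
  shows "gale_le (chain n) I"
proof -
  obtain p where p: "matches p I" using nonzero_matches[OF assms] by blast
  let ?q = "\<lambda>x. p (inv_into {..<k} (cut n) x)"
  have "bij_betw ?q (chain n) I"
    using bij_betw_trans[OF bij_betw_inv_into[OF bij_cut[of n]], of p I] p by (simp add: matches_def o_def)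
  moreover have "x \<le> ?q x" if x: "x \<in> chain n" for x
  proof -
    obtain s where s: "s < k" "x = f s" using x f_le_z z_less by (force simp: chain_def)
    have "cut n s = x" using s f_le_z z_less by force
    then have "inv_into {..<k} (cut n) x = s"
      using inv_into_f_f[of "cut n" "{..<k}" s] bij_cut[of n] s by (simp add: bij_betw_def)
    then show ?thesis using p s by (simp add: matches_def)
  qed
  ultimately show ?thesis using gale_leI finite_chain by blast
qed

lemma Imin_eq_chain: "Imin n P k = chain n"
  unfolding Imin_def
proof (rule the_equality)
  show "chain n \<subseteq> {..<n} \<and> card (chain n) = k \<and> P (chain n) \<noteq> 0 \<and>
      (\<forall>J. J \<subseteq> {..<n} \<and> card J = k \<and> P J \<noteq> 0 \<longrightarrow> gale_le (chain n) J)"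
    using chain_subset card_chain chain_nonzero gale_le_chain by blast
next
  fix I assume I: "I \<subseteq> {..<n} \<and> card I = k \<and> P I \<noteq> 0 \<and>
      (\<forall>J. J \<subseteq> {..<n} \<and> card J = k \<and> P J \<noteq> 0 \<longrightarrow> gale_le I J)"
  then have "gale_le I (chain n)" using chain_subset card_chain chain_nonzero by blast
  moreover have "gale_le (chain n) I" using I gale_le_chain by blast
  ultimately show "I = chain n" using gale_le_antisym I finite_chain finite_subset by blast
qed

text \<open>With \<open>c = f s\<close>, the row \<open>s\<close> is the only one whose choice
  differs between the thresholds \<open>Suc c\<close> and \<open>c\<close>. It remains to see that
  \<open>Xi\<close> selects exactly the exchange of \<open>f s\<close> for \<open>z s\<close>; both
  maxima are settled by sums of columns.\<close>

lemma Xi_chain: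
  assumes s: "s < k" and ne: "z s \<noteq> f s"
  shows "Xi n P (chain (Suc (f s))) = chain (f s)"
proof -
  let ?c = "f s" let ?I = "chain (Suc ?c)"
  let ?T = "{t. t < k \<and> Suc ?c \<le> f t}" and ?T' = "{t. t < k \<and> ?c \<le> f t}"
  have T': "?T' = insert s ?T" using s f_inj by (auto simp: le_less Suc_le_eq dest: inj_onD)
  have lt: "?c < z s" using f_le_z[OF s] ne by simp
  have cI: "?c \<in> ?I" using s by (auto simp: chain_def)
  have zI: "z s \<notin> ?I"
  proof
    assume "z s \<in> ?I"
    then have "z s \<in> z ` ?T" using lt chain_upper[of "Suc ?c"] by auto
    then obtain t where t: "t < k" "Suc ?c \<le> f t" "z s = z t" by auto
    then have "s = t" using inj_onD[OF z_inj, of s t] s by simp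
    then show False using t(2) by simp
  qed
  have exch: "insert (z s) (?I - {?c}) = chain ?c"
  proof -
    have "f ` {t. t < k \<and> f t < Suc ?c} = insert ?c (f ` {t. t < k \<and> f t < ?c})"
      using s by (auto simp: less_Suc_eq)
    moreover have "?c \<notin> z ` ?T" using f_le_z by fastforce
    ultimately show ?thesis unfolding chain_def T' by auto
  qed
  have zT: "inj_on z ?T" using z_inj by (rule inj_on_subset) auto
  have zT': "inj_on z ?T'" using z_inj by (rule inj_on_subset) auto
  have exI: "insert j (?I - {i}) \<subseteq> {..<n} \<and> card (insert j (?I - {i})) = k \<and> finite (insert j (?I - {i}))"
    if "i \<in> ?I" "j < n" "j \<notin> ?I" for i j
    using exchange_set_props[OF finite_chain that(1,3)] chain_subset[of "Suc ?c"] that(2) card_chain by auto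
  \<comment> \<open>Above \<open>c\<close> the set already consists of trailing columns, so
    replacing one by a larger column exceeds the maximal sum.\<close>
  have stuck: "P (insert j (?I - {i})) = 0" if i: "i \<in> ?I" "?c < i" and j: "j < n" "j \<notin> ?I" "i < j" for i j
  proof (rule ccontr)
    assume "P (insert j (?I - {i})) \<noteq> 0"
    then obtain p where p: "matches p (insert j (?I - {i}))" using nonzero_matches exI[OF i(1) j(1,2)] by blast
    have iz: "i \<in> z ` ?T" using i chain_upper[of "Suc ?c"] by auto
    have up: "insert j (?I - {i}) \<inter> {Suc ?c..} = insert j (z ` ?T - {i})"
      using chain_upper[of "Suc ?c"] i j by auto
    have jz: "j \<notin> z ` ?T" using j chain_upper[of "Suc ?c"] by blast
    have "card (insert j (z ` ?T - {i})) = card ?T"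
      using exchange_set_props(2)[OF _ iz jz] card_image[OF zT] by simp
    then have "\<Sum> (insert j (z ` ?T - {i})) \<le> \<Sum> (z ` ?T)"
      using matches_upper(3)[OF p, of "Suc ?c"] exI[OF i(1) j(1,2)] unfolding up by simp
    moreover have "\<Sum> (insert j (z ` ?T - {i})) = j + \<Sum> (z ` ?T - {i})" using jz by simp
    moreover have "\<Sum> (z ` ?T) = i + \<Sum> (z ` ?T - {i})" using iz by (intro sum.remove) auto
    ultimately show False using j(3) by linarith
  qed
  \<comment> \<open>Counted from \<open>c\<close> on, row \<open>s\<close> joins the upper rows and
    adds \<open>z s\<close> to the bound, so the new column is at most \<open>z s\<close>.\<close>
  have furthest: "j \<le> z s" if j: "j < n" "j \<notin> ?I" "P (insert j (?I - {?c})) \<noteq> 0" for j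
  proof (rule ccontr)
    assume "\<not> j \<le> z s"
    then have js: "z s < j" by simp
    obtain p where p: "matches p (insert j (?I - {?c}))" using nonzero_matches exI[OF cI j(1,2)] j(3) by blast
    have up: "insert j (?I - {?c}) \<inter> {?c..} = insert j (z ` ?T)"
    proof -
      have "?I \<inter> {?c..} = insert ?c (?I \<inter> {Suc ?c..})" using cI by (auto simp: Suc_le_eq le_less)
      then have "?I \<inter> {?c..} = insert ?c (z ` ?T)" by (simp only: chain_upper)
      moreover have "?c \<notin> z ` ?T" using f_le_z by fastforce
      then have "insert ?c (z ` ?T) - {?c} = z ` ?T" by (rule Diff_insert_absorb)
      moreover have "insert j (?I - {?c}) \<inter> {?c..} = insert j ((?I \<inter> {?c..}) - {?c})" using js lt by auto
      ultimately show ?thesis by (simp only:)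
    qed
    have jz: "j \<notin> z ` ?T" using j chain_upper[of "Suc ?c"] by blast
    have sT: "s \<notin> ?T" by simp
    have "card (insert j (z ` ?T)) = card ?T'" using jz card_image[OF zT] by (simp add: T')
    then have "\<Sum> (insert j (z ` ?T)) \<le> \<Sum> (z ` ?T')"
      using matches_upper(3)[OF p, of ?c] exI[OF cI j(1,2)] unfolding up by simp
    moreover have "\<Sum> (insert j (z ` ?T)) = j + \<Sum> (z ` ?T)" using jz by simp
    moreover have "\<Sum> (z ` ?T') = z s + \<Sum> (z ` ?T)"
      using zI chain_upper[of "Suc ?c"] lt unfolding T' by (subst image_insert, subst sum.insert) auto
    ultimately show False using js by linarith
  qed
  have PI: "P ?I \<noteq> 0" by (rule chain_nonzero)
  have Pz: "P (insert (z s) (?I - {?c})) \<noteq> 0" unfolding exch by (rule chain_nonzero)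
  let ?B = "{i \<in> ?I. \<exists>j<n. j \<notin> ?I \<and> i < j \<and> P (insert j (?I - {i})) \<noteq> 0}"
  have cB: "?c \<in> ?B" using cI zI z_less[OF s] lt Pz by auto
  have B: "Max ?B = ?c"
    by (rule Max_eqI) (use finite_chain cB stuck in \<open>auto simp: not_le[symmetric]\<close>)
  have A: "Max {j. j < n \<and> j \<notin> ?I \<and> P (insert j (?I - {?c})) \<noteq> 0} = z s"
    by (rule Max_eqI) (use furthest zI z_less[OF s] Pz in auto)
  have "Xi n P ?I = insert (z s) (?I - {?c})"
    unfolding Xi_def Let_def B A using PI cB by auto
  then show ?thesis using exch by simp
qed

lemma chain_step: "chain c = chain (Suc c) \<or> chain c = Xi n P (chain (Suc c))"
proof (cases "\<exists>s<k. f s = c \<and> z s \<noteq> f s")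
  case True
  then show ?thesis using Xi_chain by auto
next
  case False
  then have *: "cut c s = cut (Suc c) s" if "s < k" for s using that by (auto simp: less_Suc_eq)
  have "chain c = cut c ` {..<k}" "chain (Suc c) = cut (Suc c) ` {..<k}"
    using bij_cut by (auto simp: bij_betw_def)
  then have "chain c = chain (Suc c)" using * by (auto intro!: image_cong)
  then show ?thesis by simp
qed

lemma chain_in_orbit: "\<exists>m. chain c = (Xi n P ^^ m) (Imin n P k)"
proof (cases "c \<le> n")
  case True
  then show ?thesis
  proof (induction rule: inc_induct)
    case base
    show ?case using Imin_eq_chain by (intro exI[of _ 0]) simp
  next
    case (step c)
    then obtain m where m: "chain (Suc c) = (Xi n P ^^ m) (Imin n P k)" by blast
    from chain_step[of c] show ?case
    proof
      assume "chain c = Xi n P (chain (Suc c))"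
      then show ?thesis using m by (intro exI[of _ "Suc m"]) simp
    qed (use m in auto)
  qed
next
  case False
  have "cut c s = cut n s" if "s < k" for s using that f_le_z[of s] z_less[of s] False by simp
  moreover have "chain c = cut c ` {..<k}" "chain n = cut n ` {..<k}"
    using bij_cut by (auto simp: bij_betw_def)
  ultimately have "chain c = chain n" by (auto intro!: image_cong)
  then show ?thesis using Imin_eq_chain by (intro exI[of _ 0]) simp
qed

end

section \<open>Leibniz expansion and matchings of rows with columns\<close>

lemma coldet_unique_match:
  assumes I: "finite I" "card I = k" and h: "bij_betw h {..<k} I"
    and uniq: "\<And>p. bij_betw p {..<k} I \<Longrightarrow> (\<And>s. s < k \<Longrightarrow> g s (p s) \<noteq> 0) \<Longrightarrow> (\<And>s. s < k \<Longrightarrow> p s = h s)"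
  shows "\<bar>minor k g I\<bar> = (\<Prod>s<k. \<bar>g s (h s)\<bar>)"
proof -
  note p = pick_props[OF I]
  have pb: "bij_betw (pick I) {..<k} I" using p(1,2) by (simp add: bij_betw_def)
  define \<sigma> where "\<sigma> s = (if s < k then inv_into {..<k} (pick I) (h s) else s)" for s
  have "bij_betw (inv_into {..<k} (pick I) \<circ> h) {..<k} {..<k}"
    by (rule bij_betw_trans[OF h bij_betw_inv_into[OF pb]])
  then have "bij_betw \<sigma> {..<k} {..<k}" by (rule bij_betw_cong[THEN iffD1, rotated]) (simp add: \<sigma>_def)
  then have \<sigma>: "\<sigma> permutes {0..<k}"
    by (intro bij_imp_permutes) (auto simp: \<sigma>_def lessThan_atLeast0)
  have pick\<sigma>: "pick I (\<sigma> s) = h s" if "s < k" for s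
    using that h p(2) by (simp add: \<sigma>_def f_inv_into_f bij_betwE)
  let ?A = "mat k k (\<lambda>(s,t). g s (pick I t))"
  have "minor k g I = (\<Sum>q\<in>{q. q permutes {0..<k}}. signof q * (\<Prod>s=0..<k. ?A $$ (s, q s)))"
    unfolding coldet_def by (rule det_def') simp
  also have "\<dots> = (\<Sum>q\<in>{q. q permutes {0..<k}}. if q = \<sigma> then signof \<sigma> * (\<Prod>s=0..<k. g s (h s)) else 0)"
  proof (rule sum.cong[OF refl])
    fix q assume "q \<in> {q. q permutes {0..<k}}"
    then have q: "q permutes {0..<k}" by simp
    have qk: "q s < k" if "s < k" for s using permutes_in_image[OF q, of s] that by simp
    have prod: "(\<Prod>s=0..<k. ?A $$ (s, q s)) = (\<Prod>s=0..<k. g s (pick I (q s)))"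
      by (rule prod.cong) (use qk in auto)
    show "signof q * (\<Prod>s=0..<k. ?A $$ (s, q s)) = (if q = \<sigma> then signof \<sigma> * (\<Prod>s=0..<k. g s (h s)) else 0)"
    proof (cases "q = \<sigma>")
      case True
      then show ?thesis unfolding prod by (simp add: pick\<sigma>)
    next
      case False
      have "\<exists>s<k. g s (pick I (q s)) = 0"
      proof (rule ccontr)
        assume *: "\<not> ?thesis"
        have "bij_betw q {..<k} {..<k}" using permutes_imp_bij[OF q] by (simp add: lessThan_atLeast0)
        then have "bij_betw (pick I \<circ> q) {..<k} I" by (rule bij_betw_trans[OF _ pb])
        then have "pick I (q s) = h s" if "s < k" for s using uniq[of "pick I \<circ> q"] * that by auto
        then have "q s = \<sigma> s" if "s < k" for s
          using that pick\<sigma>[OF that] qk[OF that] permutes_in_image[OF \<sigma>, of s] inj_onD[OF p(1), of "q s" "\<sigma> s"] by simp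
        then have "q = \<sigma>" using permutes_not_in[OF q] permutes_not_in[OF \<sigma>] by (metis atLeastLessThan_iff ext)
        then show False using False by simp
      qed
      then have "(\<Prod>s=0..<k. g s (pick I (q s))) = 0" by (intro prod_zero) auto
      then show ?thesis unfolding prod using False by simp
    qed
  qed
  also have "\<dots> = signof \<sigma> * (\<Prod>s=0..<k. g s (h s))" using \<sigma> by (simp add: finite_permutations)
  finally have "\<bar>minor k g I\<bar> = \<bar>signof \<sigma> :: real\<bar> * \<bar>\<Prod>s=0..<k. g s (h s)\<bar>" by (simp add: abs_mult)
  moreover have "\<bar>signof \<sigma> :: real\<bar> = 1" by (simp add: sign_def)
  ultimately show ?thesis by (simp add: abs_prod lessThan_atLeast0)
qed

lemma coldet_nonzero_match:
  assumes I: "finite I" "card I = k" and "minor k g I \<noteq> 0"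
  shows "\<exists>p. bij_betw p {..<k} I \<and> (\<forall>s<k. g s (p s) \<noteq> 0)"
proof -
  note p = pick_props[OF I]
  have pb: "bij_betw (pick I) {..<k} I" using p(1,2) by (simp add: bij_betw_def)
  let ?A = "mat k k (\<lambda>(s,t). g s (pick I t))"
  have "minor k g I = (\<Sum>q\<in>{q. q permutes {0..<k}}. signof q * (\<Prod>s=0..<k. ?A $$ (s, q s)))"
    unfolding coldet_def by (rule det_def') simp
  then obtain q where q: "q permutes {0..<k}" "signof q * (\<Prod>s=0..<k. ?A $$ (s, q s)) \<noteq> 0"
    using assms(3) by (metis (no_types, lifting) mem_Collect_eq sum.neutral)
  have qk: "q s < k" if "s < k" for s using permutes_in_image[OF q(1), of s] that by simp
  have "g s (pick I (q s)) \<noteq> 0" if "s < k" for s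
  proof
    assume "g s (pick I (q s)) = 0"
    then have "(\<Prod>s=0..<k. ?A $$ (s, q s)) = 0" using that qk by (intro prod_zero) auto
    then show False using q(2) by simp
  qed
  moreover have "bij_betw q {..<k} {..<k}" using permutes_imp_bij[OF q(1)] by (simp add: lessThan_atLeast0)
  then have "bij_betw (pick I \<circ> q) {..<k} I" by (rule bij_betw_trans[OF _ pb])
  ultimately show ?thesis by (intro exI[of _ "pick I \<circ> q"]) auto
qed

section \<open>Laurent monomials\<close>

lemma act_commute:
  assumes "Suc (fst l) < fst m \<or> Suc (fst m) < fst l"
  shows "act J a l (act J a m x) = act J a m (act J a l x)"
  using assms by (intro ext) (auto simp: act_def)

lemma pmat_comm:
  assumes "comm fst L L'"
  shows "pmat J a L = pmat J a L'"
  using assms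
proof induction
  case (swap xs us l m vs)
  have "rowv J a (us @ [l, m] @ vs) x = rowv J a (us @ [m, l] @ vs) x" for x
    using act_commute[OF swap.hyps(2)] by (simp add: rowv_append rowv_Cons)
  then show ?case using swap.IH by (simp add: pmat_def fun_eq_iff)
qed simp

lemma weight_high: "(\<And>l. l \<in> set L \<Longrightarrow> fst l < z) \<Longrightarrow> weight J a L z = 1"
proof (induction L)
  case (Cons l L)
  then have "fst l < z" "weight J a L z = 1" by simp_all
  then show ?case by (simp add: shift_def)
qed simp

text \<open>Letters before \<open>l\<close> in the run are larger and leave the position alone;
  letter \<open>l\<close> moves it above all later letters. Only one parameter is collected, so it
  can be isolated by a division.\<close>

lemma weight_group:
  assumes "map fst G = rev [q..<m]" "l \<in> set G"
  shows "weight J a G (fst l) = (if snd l \<in> J then 1 else a (snd l))"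
  using assms
proof (induction m arbitrary: G)
  case (Suc m)
  have "q \<le> m" using Suc.prems by (cases "q \<le> m") auto
  then obtain l0 G' where G: "G = l0 # G'" "fst l0 = m" "map fst G' = rev [q..<m]"
    using Suc.prems(1) by (auto simp: map_eq_Cons_conv)
  have G': "fst l' < m" if "l' \<in> set G'" for l'
  proof -
    have "fst l' \<in> set (map fst G')" using that by simp
    then show ?thesis unfolding G(3) set_rev set_upt by simp
  qed
  show ?case
  proof (cases "l \<in> set G'")
    case True
    then show ?thesis using Suc.IH[OF G(3) True] G'[OF True] G by (simp add: shift_def)
  next
    case False
    then have "l = l0" using Suc.prems(2) G by simp
    moreover have "weight J a G' (Suc m) = 1" by (rule weight_high) (use G' less_SucI in blast)
    ultimately show ?thesis using G by (simp add: shift_def)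
  qed
qed simp

lemma Xi_props:
  assumes "I \<subseteq> {..<n}" "P I \<noteq> 0"
  shows "Xi n P I \<subseteq> {..<n}" "P (Xi n P I) \<noteq> 0"
proof -
  define B where "B = {i \<in> I. \<exists>j<n. j \<notin> I \<and> i < j \<and> P (insert j (I - {i})) \<noteq> 0}"
  define A where "A = {j. j < n \<and> j \<notin> I \<and> P (insert j (I - {Max B})) \<noteq> 0}"
  have Xi: "Xi n P I = (if B \<noteq> {} then insert (Max A) (I - {Max B}) else I)"
    unfolding Xi_def Let_def B_def[symmetric] A_def[symmetric] using assms(2) by (simp only: simp_thms)
  have "Max A \<in> A" if "B \<noteq> {}"
  proof (rule Max_in)
    have "finite B" using finite_subset[OF assms(1)] by (simp add: B_def)
    then have "Max B \<in> B" using that by (rule Max_in)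
    then show "A \<noteq> {}" by (auto simp: A_def B_def)
  qed (simp add: A_def)
  then show "Xi n P I \<subseteq> {..<n}" "P (Xi n P I) \<noteq> 0" using assms by (auto simp: Xi A_def)
qed

lemma Xi_cong:
  assumes "\<And>K. K \<subseteq> {..<n} \<Longrightarrow> P K = 0 \<longleftrightarrow> P' K = 0" "I \<subseteq> {..<n}"
  shows "Xi n P I = Xi n P' I"
proof -
  have "P I = 0 \<longleftrightarrow> P' I = 0" by (rule assms(1)[OF assms(2)])
  moreover have *: "P (insert j (I - {i})) = 0 \<longleftrightarrow> P' (insert j (I - {i})) = 0" if "j < n" for i j
    by (rule assms(1)) (use assms(2) that in auto)
  have "{i \<in> I. \<exists>j<n. j \<notin> I \<and> i < j \<and> P (insert j (I - {i})) \<noteq> 0}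
      = {i \<in> I. \<exists>j<n. j \<notin> I \<and> i < j \<and> P' (insert j (I - {i})) \<noteq> 0}" using * by blast
  moreover have "{j. j < n \<and> j \<notin> I \<and> P (insert j (I - {b})) \<noteq> 0}
      = {j. j < n \<and> j \<notin> I \<and> P' (insert j (I - {b})) \<noteq> 0}" for b using * by blast
  ultimately show ?thesis unfolding Xi_def Let_def by (simp only:)
qed

lemma plucker_eq_minor:
  assumes "M \<in> carrier_mat n n" "I \<subseteq> {..<n}"
    "\<And>r c. r < n \<Longrightarrow> c < n \<Longrightarrow> M $$ (r, c) = g r c"
  shows "plucker M I = minor (card I) g I"
proof -
  have fin: "finite I" using assms(2) finite_subset by blast
  have k: "card I \<le> n" using card_mono[OF _ assms(2)] by simp
  have p1: "pick {..<card I} s = s" if "s < card I" for s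
    by (rule pick_unique[of "card I" "\<lambda>x. x"]) (use that in auto)
  have "{i. i < n \<and> i \<in> {..<card I}} = {..<card I}" "{j. j < n \<and> j \<in> I} = I" using k assms(2) by auto
  then have "submatrix M {..<card I} I = mat (card I) (card I) (\<lambda>(s,t). g s (pick I t))"
    using assms(1) pick_mem[OF fin refl] assms(2) k p1
    by (intro eq_matI) (auto simp: submatrix_def intro!: assms(3))
  then show ?thesis by (simp add: plucker_def coldet_def)
qed

text \<open>\<open>L\<close> is the reordered list, while \<open>Pl\<close> is meant to be the
  Pluecker vector of the product in its original order; the tags keep the parameters the same for
  both.\<close>

locale grouped_factorization =
  fixes n :: nat and J :: "nat set" and q :: "nat \<Rightarrow> nat" and L :: "(nat \<times> nat) list"
    and Pl :: "(nat \<Rightarrow> real) \<Rightarrow> nat set \<Rightarrow> real"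
  assumes distinguished: "distinguished [] J L" and groups: "map fst L = groups q (n - 1)"
    and Pl_minor: "I \<subseteq> {..<n} \<Longrightarrow> Pl a I = minor (card I) (pmat J a L) I"
begin

definition pos :: "(nat \<Rightarrow> real) \<Rightarrow> bool" where
  "pos a \<longleftrightarrow> (\<forall>l\<in>set L. snd l \<notin> J \<longrightarrow> 0 < a (snd l))"

text \<open>The all-ones vector serves as a positive reference point; \<open>extremal_eq\<close>
  later removes the dependence on it.\<close>

definition E :: "nat set set" where
  "E = extremal n (Pl (\<lambda>_. 1))"

lemma pos_one: "pos (\<lambda>_. 1)"
  by (simp add: pos_def)

lemma Pl_nonneg_support:
  assumes "pos a" "I \<subseteq> {..<n}"
  shows "0 \<le> Pl a I" "Pl a I = 0 \<longleftrightarrow> Pl (\<lambda>_. 1) I = 0"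
  using minor_nonneg_support[OF distinguished, of a "\<lambda>_. 1" I "card I"] assms finite_subset[OF assms(2)]
  unfolding Pl_minor[OF assms(2)] pos_def by simp_all

section \<open>The coordinates of level \<open>Suc m\<close>\<close>

context
  fixes m :: nat and L1 L2 :: "(nat \<times> nat) list"
  assumes m: "m < n - 1" and L: "L = L1 @ L2" and L1: "map fst L1 = groups q m"
    and L2: "map fst L2 = concat (map (\<lambda>j. rev [q j..<Suc j]) [m..<n - 1])"
begin

lemma L1_less: "l \<in> set L1 \<Longrightarrow> Suc (fst l) < Suc m"
proof -
  assume "l \<in> set L1"
  then have "fst l \<in> set (map fst L1)" by simp
  then show ?thesis unfolding L1 groups_def by auto
qed

lemma L2_less: "l \<in> set L2 \<Longrightarrow> fst l < n - 1"
proof -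
  assume "l \<in> set L2"
  then have "fst l \<in> set (map fst L2)" by simp
  then show ?thesis unfolding L2 by auto
qed

lemma pos_L2: "pos a \<Longrightarrow> l \<in> set L2 \<Longrightarrow> snd l \<notin> J \<Longrightarrow> 0 < a (snd l)"
proof -
  have "set L2 \<subseteq> set L" by (simp add: L)
  then show "pos a \<Longrightarrow> l \<in> set L2 \<Longrightarrow> snd l \<notin> J \<Longrightarrow> 0 < a (snd l)" unfolding pos_def by blast
qed

lemma Pl_level:
  assumes "I \<subseteq> {..<n}" "card I = Suc m"
  shows "Pl a I = minor (Suc m) (pmat J a L2) I"
  unfolding Pl_minor[OF assms(1)] assms(2) L by (rule minor_append_block[OF L1_less])

lemma level_rows:
  assumes "pos a"
  shows "inj_on (trail L2) {..<Suc m}" "s < Suc m \<Longrightarrow> \<bar>pmat J a L2 s (winv (dword J L2) s)\<bar> = 1"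
    "s < Suc m \<Longrightarrow> c < winv (dword J L2) s \<Longrightarrow> pmat J a L2 s c = 0"
    "s < Suc m \<Longrightarrow> \<bar>pmat J a L2 s (trail L2 s)\<bar> = weight J a L2 s"
    "s < Suc m \<Longrightarrow> trail L2 s < c \<Longrightarrow> pmat J a L2 s c = 0"
proof -
  have "distinguished [] J L2" using distinguished unfolding L by (simp add: distinguished_append)
  moreover have "unobstructed L2 {..<Suc m}" by (rule unobstructed_groups[OF L2]) auto
  ultimately have "inj_on (trail L2) {..<Suc m} \<and> (\<forall>s<Suc m.
    \<bar>pmat J a L2 s (winv (dword J L2) s)\<bar> = 1 \<and> (\<forall>c<winv (dword J L2) s. pmat J a L2 s c = 0) \<and>
    \<bar>pmat J a L2 s (trail L2 s)\<bar> = weight J a L2 s \<and> (\<forall>c>trail L2 s. pmat J a L2 s c = 0))"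
    by (rule leading_trailing) (rule pos_L2[OF assms])
  then show "inj_on (trail L2) {..<Suc m}" "s < Suc m \<Longrightarrow> \<bar>pmat J a L2 s (winv (dword J L2) s)\<bar> = 1"
    "s < Suc m \<Longrightarrow> c < winv (dword J L2) s \<Longrightarrow> pmat J a L2 s c = 0"
    "s < Suc m \<Longrightarrow> \<bar>pmat J a L2 s (trail L2 s)\<bar> = weight J a L2 s"
    "s < Suc m \<Longrightarrow> trail L2 s < c \<Longrightarrow> pmat J a L2 s c = 0" by blast+
qed

lemma level_matching: "matching_system n (Suc m) (winv (dword J L2)) (trail L2)"
proof
  show "inj_on (winv (dword J L2)) {..<Suc m}" by (rule inj_on_subset[OF inj_winv]) simp
  show "inj_on (trail L2) {..<Suc m}" by (rule level_rows(1)[OF pos_one])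
  show "winv (dword J L2) s \<le> trail L2 s" if "s < Suc m" for s
    using level_rows(2,5)[OF pos_one that] by (metis abs_zero linorder_not_le zero_neq_one)
  show "trail L2 s < n" if "s < Suc m" for s
    using trail_le[of L2 "n - 1" s] L2_less m that by fastforce
qed

text \<open>The chains are determined by leading and trailing positions alone, so one interpretation
  serves all parameter vectors.\<close>

interpretation matching_system n "Suc m" "\<lambda>_. 0" "winv (dword J L2)" "trail L2"
  by (rule level_matching)

lemma matchesI:
  assumes "pos a" "bij_betw p {..<Suc m} I" "\<And>s. s < Suc m \<Longrightarrow> pmat J a L2 s (p s) \<noteq> 0"
  shows "matches p I"
  unfolding matches_def using assms(2,3) level_rows(3,5)[OF assms(1)] by (meson linorder_not_le)

lemma abs_Pl_chain:
  assumes "pos a"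
  shows "\<bar>Pl a (chain c)\<bar> = (\<Prod>s<Suc m. if winv (dword J L2) s < c then 1 else weight J a L2 s)"
proof -
  have "\<bar>Pl a (chain c)\<bar> = (\<Prod>s<Suc m. \<bar>pmat J a L2 s (cut c s)\<bar>)"
    unfolding Pl_level[OF chain_subset card_chain]
    by (rule coldet_unique_match[OF finite_chain card_chain bij_cut])
       (use matches_chain_unique matchesI[OF assms] in blast)
  also have "\<dots> = (\<Prod>s<Suc m. if winv (dword J L2) s < c then 1 else weight J a L2 s)"
    by (rule prod.cong) (use level_rows(2,4)[OF assms] in auto)
  finally show ?thesis .
qed

lemma weight_L2_pos: "pos a \<Longrightarrow> 0 < weight J a L2 s"
  by (rule weight_pos) (rule pos_L2)

lemma Pl_chain:
  assumes "pos a"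
  shows "Pl a (chain c) = (\<Prod>s<Suc m. if winv (dword J L2) s < c then 1 else weight J a L2 s)" "0 < Pl a (chain c)"
proof -
  show 1: "Pl a (chain c) = (\<Prod>s<Suc m. if winv (dword J L2) s < c then 1 else weight J a L2 s)"
    using abs_Pl_chain[OF assms, of c] Pl_nonneg_support(1)[OF assms chain_subset, of c] by simp
  show "0 < Pl a (chain c)" unfolding 1 by (rule prod_pos) (use weight_L2_pos[OF assms] in auto)
qed

lemma level_extremal: "pos a \<Longrightarrow> extremal_system n (Suc m) (Pl a) (winv (dword J L2)) (trail L2)"
proof (intro extremal_system.intro level_matching extremal_system_axioms.intro)
  assume a: "pos a"
  show "Pl a (chain c) \<noteq> 0" for c using Pl_chain(2)[OF a, of c] by simp
  fix I assume I: "I \<subseteq> {..<n}" "card I = Suc m" "Pl a I \<noteq> 0"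
  have "finite I" using I(1) finite_subset by blast
  then show "\<exists>p. matches p I"
    using coldet_nonzero_match[of I "Suc m" "pmat J a L2"] I Pl_level[OF I(1,2)] matchesI[OF a] by metis
qed

lemma chain_extremal: "chain c \<in> extremal n (Pl (\<lambda>_. 1))"
proof -
  obtain i where i: "chain c = (Xi n (Pl (\<lambda>_. 1)) ^^ i) (Imin n (Pl (\<lambda>_. 1)) (Suc m))"
    using extremal_system.chain_in_orbit[OF level_extremal[OF pos_one]] by blast
  have "1 \<le> Suc m" "Suc m < n" using m by simp_all
  then show ?thesis using i unfolding extremal_def mem_Collect_eq by blast
qed

lemma Imin_level: "pos a \<Longrightarrow> Imin n (Pl a) (Suc m) = chain n"
  by (rule extremal_system.Imin_eq_chain[OF level_extremal])

text \<open>By injectivity of the leading positions, the two thresholds differ only in row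
  \<open>s\<close>, which contributes its trailing entry in the numerator and absolute value 1 in
  the denominator.\<close>

lemma weight_ratio:
  assumes "pos a" "s < Suc m"
  shows "weight J a L2 s = Pl a (chain (winv (dword J L2) s)) / Pl a (chain (Suc (winv (dword J L2) s)))"
proof -
  let ?f = "winv (dword J L2)"
  have "Pl a (chain (?f s)) = weight J a L2 s * (\<Prod>t\<in>{..<Suc m} - {s}. if ?f t < ?f s then 1 else weight J a L2 t)"
    unfolding Pl_chain(1)[OF assms(1)] using assms(2) by (subst prod.remove[of _ s]) auto
  moreover have "Pl a (chain (Suc (?f s))) = (\<Prod>t\<in>{..<Suc m} - {s}. if ?f t < Suc (?f s) then 1 else weight J a L2 t)"
    unfolding Pl_chain(1)[OF assms(1)] using assms(2) by (subst prod.remove[of _ s]) auto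
  moreover have "\<dots> = (\<Prod>t\<in>{..<Suc m} - {s}. if ?f t < ?f s then 1 else weight J a L2 t)"
    by (rule prod.cong) (auto simp: less_Suc_eq)
  ultimately have "Pl a (chain (?f s)) = weight J a L2 s * Pl a (chain (Suc (?f s)))" by (simp only:)
  moreover have "Pl a (chain (Suc (?f s))) \<noteq> 0" using Pl_chain(2)[OF assms(1), of "Suc (?f s)"] by simp
  ultimately show ?thesis by (simp only: nonzero_mult_div_cancel_right not_False_eq_True)
qed

lemmas level_facts = chain_extremal chain_subset Pl_chain(2) Imin_level weight_ratio

end

lemma split_level:
  assumes "m \<le> n - 1"
  obtains L1 L2 where "L = L1 @ L2" "map fst L1 = groups q m"
    "map fst L2 = concat (map (\<lambda>j. rev [q j..<Suc j]) [m..<n - 1])"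
proof -
  have "[0..<n - 1] = [0..<m] @ [m..<n - 1]" using assms by (metis le_add_diff_inverse upt_add_eq_append zero_le)
  then have "map fst L = groups q m @ concat (map (\<lambda>j. rev [q j..<Suc j]) [m..<n - 1])"
    unfolding groups groups_def by simp
  then show ?thesis using that unfolding map_eq_append_conv by metis
qed

section \<open>Independence of the extremal indices from the parameters\<close>

lemma Imin_eq:
  assumes "pos a" "1 \<le> k" "k < n"
  shows "Imin n (Pl a) k = Imin n (Pl (\<lambda>_. 1)) k" "Imin n (Pl a) k \<subseteq> {..<n}" "Pl a (Imin n (Pl a) k) \<noteq> 0"
proof -
  obtain m where k: "k = Suc m" using assms(2) by (cases k) auto
  have m: "m < n - 1" using assms(3) k by simp
  obtain L1 L2 where s: "L = L1 @ L2" "map fst L1 = groups q m"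
    "map fst L2 = concat (map (\<lambda>j. rev [q j..<Suc j]) [m..<n - 1])" by (rule split_level[of m]) (use m in simp)
  note f = level_facts[OF m s]
  show "Imin n (Pl a) k = Imin n (Pl (\<lambda>_. 1)) k" "Imin n (Pl a) k \<subseteq> {..<n}" "Pl a (Imin n (Pl a) k) \<noteq> 0"
    unfolding k f(4)[OF assms(1)] f(4)[OF pos_one] using f(2) f(3)[OF assms(1), of n] by auto
qed

text \<open>\<open>Xi\<close> sees only which coordinates vanish. Containment in
  \<open>{..<n}\<close> and nonvanishing are carried along because they are what allows the next
  step.\<close>

lemma orbit_eq:
  assumes "pos a" "1 \<le> k" "k < n"
  shows "(Xi n (Pl a) ^^ i) (Imin n (Pl a) k) = (Xi n (Pl (\<lambda>_. 1)) ^^ i) (Imin n (Pl (\<lambda>_. 1)) k) \<and>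
    (Xi n (Pl a) ^^ i) (Imin n (Pl a) k) \<subseteq> {..<n} \<and> Pl a ((Xi n (Pl a) ^^ i) (Imin n (Pl a) k)) \<noteq> 0"
proof (induction i)
  case 0
  then show ?case using Imin_eq[OF assms] by simp
next
  case (Suc i)
  let ?I = "(Xi n (Pl a) ^^ i) (Imin n (Pl a) k)"
  have I: "?I \<subseteq> {..<n}" "Pl a ?I \<noteq> 0" "?I = (Xi n (Pl (\<lambda>_. 1)) ^^ i) (Imin n (Pl (\<lambda>_. 1)) k)"
    using Suc by auto
  have "Xi n (Pl a) ?I = Xi n (Pl (\<lambda>_. 1)) ?I"
    by (rule Xi_cong[OF Pl_nonneg_support(2)[OF assms(1)] I(1)])
  then show ?case using Xi_props[where P = "Pl a", OF I(1,2)] unfolding funpow.simps o_apply I(3)[symmetric] by blast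
qed

lemma extremal_eq: "pos a \<Longrightarrow> extremal n (Pl a) = E"
  unfolding E_def extremal_def using orbit_eq[of a] by (auto simp: set_eq_iff) metis+

lemma E_props:
  assumes "pos a" "I \<in> E"
  shows "I \<subseteq> {..<n}" "0 < Pl a I"
proof -
  have "I \<in> extremal n (Pl a)" using assms extremal_eq by simp
  then have "I \<subseteq> {..<n} \<and> Pl a I \<noteq> 0" unfolding extremal_def using orbit_eq[OF assms(1)] by blast
  then show "I \<subseteq> {..<n}" "0 < Pl a I" using Pl_nonneg_support(1)[OF assms(1), of I] by auto
qed

lemma finite_E: "finite E"
  by (rule finite_subset[of _ "Pow {..<n}"]) (use E_props(1)[OF pos_one] in auto)

text \<open>The exponents are chosen before \<open>a\<close>, so one monomial works for all positive
  parameters. Closure under products and quotients spares explicit exponents.\<close>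

definition laurent :: "((nat \<Rightarrow> real) \<Rightarrow> real) \<Rightarrow> bool" where
  "laurent x \<longleftrightarrow> (\<exists>e :: nat set \<Rightarrow> int. \<forall>a. pos a \<longrightarrow> x a = (\<Prod>I\<in>E. Pl a I powi e I))"

lemma laurent_one: "laurent (\<lambda>_. 1)"
  unfolding laurent_def by (intro exI[of _ "\<lambda>_. 0"]) simp

lemma laurent_Pl: "I \<in> E \<Longrightarrow> laurent (\<lambda>a. Pl a I)"
proof -
  assume "I \<in> E"
  then have "(\<Prod>K\<in>E. Pl a K powi (if K = I then 1 else 0)) = Pl a I" for a
    using finite_E by (simp add: if_distrib[of "\<lambda>e. Pl a _ powi e"] cong: if_cong)
  then show ?thesis unfolding laurent_def by (intro exI[of _ "\<lambda>K. if K = I then 1 else 0"]) simp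
qed

lemma laurent_mult_divide:
  assumes "laurent x" "laurent y"
  shows "laurent (\<lambda>a. x a * y a)" "laurent (\<lambda>a. x a / y a)"
proof -
  obtain e e' where e: "\<And>a. pos a \<Longrightarrow> x a = (\<Prod>I\<in>E. Pl a I powi e I)"
    "\<And>a. pos a \<Longrightarrow> y a = (\<Prod>I\<in>E. Pl a I powi e' I)"
    using assms unfolding laurent_def by blast
  have ne: "Pl a I \<noteq> 0" if "pos a" "I \<in> E" for a I using E_props(2)[OF that] by simp
  have "x a * y a = (\<Prod>I\<in>E. Pl a I powi (e I + e' I))" if "pos a" for a
    unfolding e[OF that] prod.distrib[symmetric] by (rule prod.cong) (use ne[OF that] in \<open>auto simp: power_int_add\<close>)
  then show "laurent (\<lambda>a. x a * y a)" unfolding laurent_def by (intro exI[of _ "\<lambda>I. e I + e' I"]) simp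
  have "x a / y a = (\<Prod>I\<in>E. Pl a I powi (e I - e' I))" if "pos a" for a
    unfolding e[OF that] prod_dividef[symmetric] by (rule prod.cong) (use ne[OF that] in \<open>auto simp: power_int_diff\<close>)
  then show "laurent (\<lambda>a. x a / y a)" unfolding laurent_def by (intro exI[of _ "\<lambda>I. e I - e' I"]) simp
qed

lemma laurent_cong: "laurent x \<Longrightarrow> (\<And>a. pos a \<Longrightarrow> x a = y a) \<Longrightarrow> laurent y"
  unfolding laurent_def by metis

lemma laurent_weight:
  "(\<And>l. l \<in> set K \<Longrightarrow> snd l \<notin> J \<Longrightarrow> laurent (\<lambda>a. a (snd l))) \<Longrightarrow> laurent (\<lambda>a. weight J a K z)"
proof (induction K arbitrary: z)
  case (Cons l K)
  then have IH: "laurent (\<lambda>a. weight J a K (shift l z))" by simp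
  show ?case
  proof (cases "z = fst l \<and> snd l \<notin> J")
    case True
    then show ?thesis using laurent_mult_divide(1)[OF Cons.prems[of l] IH] by simp
  qed (use IH in auto)
qed (simp add: laurent_one)

text \<open>Downward induction on the run. The weight of row \<open>fst l\<close> at level
  \<open>Suc m\<close> is the parameter of \<open>l\<close> times a weight in the later runs, which
  is already a Laurent monomial.\<close>

lemma laurent_suffix:
  assumes "m \<le> n - 1" "L = L1 @ L2" "map fst L1 = groups q m"
    "map fst L2 = concat (map (\<lambda>j. rev [q j..<Suc j]) [m..<n - 1])"
    "l \<in> set L2" "snd l \<notin> J"
  shows "laurent (\<lambda>a. a (snd l))"
  using assms
proof (induction m arbitrary: L1 L2 l rule: inc_induct)
  case base
  then show ?case by simp
next
  case (step m)
  have "[m..<n - 1] = m # [Suc m..<n - 1]" using step.hyps by (simp add: upt_conv_Cons)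
  then obtain G L3 where G: "L2 = G @ L3" "map fst G = rev [q m..<Suc m]"
      "map fst L3 = concat (map (\<lambda>j. rev [q j..<Suc j]) [Suc m..<n - 1])"
    using step.prems(3) by (auto simp: map_eq_append_conv simp del: upt_Suc)
  have later: "laurent (\<lambda>a. a (snd l))" if "l \<in> set L3" "snd l \<notin> J" for l
    by (rule step.IH[of "L1 @ G", OF _ _ G(3) that]) (use step.prems(1,2) G(1,2) in \<open>simp_all only: groups_Suc map_append append_assoc\<close>)
  show ?case
  proof (cases "l \<in> set G")
    case True
    \<comment> \<open>Initially row \<open>r\<close> trails at column \<open>r\<close>, so the row
      met by letter \<open>l\<close> in its own run has the index of the letter.\<close>
    let ?s = "fst l"
    have "?s \<in> set (map fst G)" using True by simp
    then have s: "?s < Suc m" unfolding G(2) set_rev set_upt by simp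
    note facts = level_facts[OF step.hyps(2) step.prems(1-3)]
    have "laurent (\<lambda>a. weight J a L2 ?s)"
      by (rule laurent_cong[OF laurent_mult_divide(2)[OF laurent_Pl laurent_Pl]])
         (use facts(1) facts(5)[OF _ s] in \<open>auto simp: E_def\<close>)
    moreover have "laurent (\<lambda>a. weight J a L3 (trail G ?s))" by (rule laurent_weight[OF later])
    ultimately have "laurent (\<lambda>a. weight J a L2 ?s / weight J a L3 (trail G ?s))" by (rule laurent_mult_divide(2))
    then show ?thesis
    proof (rule laurent_cong)
      fix a assume a: "pos a"
      have "0 < weight J a L3 (trail G ?s)" 
      proof (rule weight_pos)
        have "set L3 \<subseteq> set L" unfolding step.prems(1) G(1) by auto
        then show "l \<in> set L3 \<Longrightarrow> snd l \<notin> J \<Longrightarrow> 0 < a (snd l)" for l using a unfolding pos_def by blast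
      qed
      then show "weight J a L2 ?s / weight J a L3 (trail G ?s) = a (snd l)"
        unfolding G(1) weight_append using weight_group[OF G(2) True, of J a] step.prems(5) by simp
    qed
  next
    case False
    then show ?thesis using later step.prems(4,5) G(1) by auto
  qed
qed

lemma laurent_coordinates: "l \<in> set L \<Longrightarrow> snd l \<notin> J \<Longrightarrow> laurent (\<lambda>a. a (snd l))"
  by (rule laurent_suffix[of 0 "[]" L]) (simp_all add: groups groups_def)

end

theorem theorem3:
  fixes n :: nat and v w :: "nat \<Rightarrow> nat"
  assumes "bruhat_le n v w"
  defines "ws \<equiv> nths (w0word n) (pds n (w0word n) w)"
  defines "J \<equiv> pds n ws v"
  shows "\<exists>E. (\<forall>a. (\<forall>j<length ws. j \<notin> J \<longrightarrow> 0 < a j) \<longrightarrow>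
                 extremal n (plucker (Mvw n ws J a)) = E) \<and>
             (\<forall>j<length ws. j \<notin> J \<longrightarrow>
                (\<exists>e :: nat set \<Rightarrow> int. \<forall>a. (\<forall>j<length ws. j \<notin> J \<longrightarrow> 0 < a j) \<longrightarrow>
                   a j = (\<Prod>I\<in>E. plucker (Mvw n ws J a) I powi e I)))"
proof -
  have w: "w permutes {..<n}" using assms(1) by (simp add: bruhat_le_def)
  have ws: "wprod ws = w" "set ws \<subseteq> {..<n-1}" "distinguished [] UNIV (tagged ws)" and "\<exists>q. wcomm ws (groups q (n - 1))"
    using pds_w0word[OF w] unfolding ws_def by blast+
  then obtain q where q: "wcomm ws (groups q (n - 1))" by blast
  obtain K where K: "is_pds n ws v K" using is_pds_exists[OF ws(2,3)] assms(1) ws(1) by blast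
  \<comment> \<open>Existence and uniqueness together turn the definite description into a usable
    set.\<close>
  have "J = K" unfolding J_def by (rule pds_eqI[OF ws(2) K])
  then have PDJ: "distinguished [] J (tagged ws)" using K is_pds_iff[OF ws(2)] by blast
  obtain L where L: "comm fst (tagged ws) L" "map fst L = groups q (n - 1)"
    using comm_lift[OF q, of fst "tagged ws"] by auto
  have "mset (tagged ws) = mset L" by (rule comm_mset[OF L(1)])
  then have setL: "set L = set (tagged ws)" by (metis set_mset_mset)
  have letters: "Suc (fst l) < n" if "l \<in> set (tagged ws)" for l
    using that ws(2) set_zip_leftD[of "fst l" "snd l" ws "[0..<length ws]"] by auto
  \<comment> \<open>Commuting factors leave the matrix unchanged, so the minors of the reordered
    list are the Pluecker coordinates of the original product.\<close>
  interpret grouped_factorization n J q L "\<lambda>a. plucker (Mvw n ws J a)"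
  proof
    show "distinguished [] J L" using PDJ distinguished_comm[OF L(1)] by simp
    show "plucker (Mvw n ws J a) I = minor (card I) (pmat J a L) I" if "I \<subseteq> {..<n}" for a I
      unfolding Mvw_eq_mprod pmat_comm[OF L(1), symmetric]
      by (rule plucker_eq_minor[OF mprod_carrier that mprod_index[OF letters]])
  qed (rule L(2))
  have tags: "snd ` set L = {..<length ws}"
    unfolding setL by (metis set_map map_snd_zip length_upt diff_zero set_upt atLeast_upt)
  have pos: "pos a \<longleftrightarrow> (\<forall>j<length ws. j \<notin> J \<longrightarrow> 0 < a j)" for a
    unfolding pos_def using tags by (metis (no_types, lifting) imageE imageI lessThan_iff)
  have coord: "laurent (\<lambda>a. a j)" if "j < length ws" "j \<notin> J" for j
  proof -
    obtain l where "l \<in> set L" "j = snd l" using tags \<open>j < length ws\<close> by (metis imageE lessThan_iff)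
    then show ?thesis using laurent_coordinates that(2) by simp
  qed
  show ?thesis
  proof (intro exI[of _ E] conjI allI impI)
    fix a :: "nat \<Rightarrow> real" assume "\<forall>j<length ws. j \<notin> J \<longrightarrow> 0 < a j"
    then have "pos a" unfolding pos .
    then show "extremal n (plucker (Mvw n ws J a)) = E" by (rule extremal_eq)
  next
    fix j assume "j < length ws" "j \<notin> J"
    from coord[OF this]
    show "\<exists>e :: nat set \<Rightarrow> int. \<forall>a. (\<forall>j<length ws. j \<notin> J \<longrightarrow> 0 < a j) \<longrightarrow>
        a j = (\<Prod>I\<in>E. plucker (Mvw n ws J a) I powi e I)"
      unfolding laurent_def pos .
  qed
qed

end
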